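(* For any $\epsilon>0$ and $k\geq 3$, there exists $d=O(1/\epsilon^2)$ such that every $(1-2k/2^k-\epsilon)$-tester for $k$-CSP with degree bound $d$ requires $\Omega(n)$ queries, where $n$ is the number of variables.
   Context: An instance of $k$-CSP (over the Boolean domain) consists of Boolean variables and constraints, each constraint being an arbitrary function $\{0,1\}^k\to\{0,1\}$ applied to a $k$-tuple of variables (required to evaluate to 1). Bounded-degree model with degree bound $d$: each variable appears in at most $d$ constraints; an algorithm accesses the instance only via an oracle that, given a variable $x$ and an index $1\le i\le d$, returns the $i$-th constraint containing $x$ (or a special symbol if none exists); query complexity is the number of oracle calls. An instance is $\epsilon$-far from satisfiability if at least $\epsilon dn/k$ constraints must be removed to make it satisfiable. An $\epsilon$-tester is a randomized algorithm that accepts every satisfiable instance with probability at least $2/3$ and rejects every instance $\epsilon$-far from satisfiability with probability at least $2/3$. *)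

theory Defs
  imports "HOL-Probability.Probability"
begin

text \<open>The variables of an instance with \<open>n\<close> variables are \<open>0, \<dots>, n - 1\<close>.  A constraint of
  arity \<open>k\<close> is a \<open>k\<close>-tuple of variables (repetitions allowed) together with a Boolean function on
  tuples of length \<open>k\<close>.  Tuples are lists; by convention the function is \<open>False\<close> on lists of any
  other length, so that it carries no information beyond its restriction to tuples of length \<open>k\<close>.\<close>

datatype cstr = Cstr (scope: "nat list") (pred: "bool list \<Rightarrow> bool")

definition kary_cstr :: "nat \<Rightarrow> nat \<Rightarrow> cstr \<Rightarrow> bool" where
  "kary_cstr k n c \<longleftrightarrow>
     length (scope c) = k \<and> set (scope c) \<subseteq> {..<n} \<and> (\<forall>ys. pred c ys \<longrightarrow> length ys = k)"

text \<open>In the bounded-degree model an instance comes with an arbitrary enumeration, for each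
  variable, of the constraints that contain it.\<close>

record csp =
  cstrs :: "cstr set"
  incident :: "nat \<Rightarrow> cstr list"

definition csp_instances :: "nat \<Rightarrow> nat \<Rightarrow> nat \<Rightarrow> csp set" where
  "csp_instances k d n = {I.
     finite (cstrs I) \<and>
     (\<forall>c\<in>cstrs I. kary_cstr k n c) \<and>
     (\<forall>x<n. distinct (incident I x) \<and>
            set (incident I x) = {c \<in> cstrs I. x \<in> set (scope c)} \<and>
            length (incident I x) \<le> d)}"

definition satisfiable :: "cstr set \<Rightarrow> bool" where
  "satisfiable S \<longleftrightarrow> (\<exists>\<sigma> :: nat \<Rightarrow> bool. \<forall>c\<in>S. pred c (map \<sigma> (scope c)))"

definition far_from_sat :: "real \<Rightarrow> nat \<Rightarrow> nat \<Rightarrow> nat \<Rightarrow> csp \<Rightarrow> bool" where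
  "far_from_sat \<epsilon> k d n I \<longleftrightarrow>
     (\<forall>R \<subseteq> cstrs I. satisfiable (cstrs I - R) \<longrightarrow> \<epsilon> * real d * real n / real k \<le> real (card R))"

text \<open>\<open>None\<close> is the special symbol; the index \<open>i\<close> is counted from 1.\<close>

definition csp_oracle :: "nat \<Rightarrow> csp \<Rightarrow> nat \<Rightarrow> nat \<Rightarrow> cstr option" where
  "csp_oracle n I x i =
     (if x < n \<and> 1 \<le> i \<and> i \<le> length (incident I x) then Some (incident I x ! (i - 1)) else None)"

text \<open>A deterministic adaptive algorithm is a decision tree whose inner nodes are oracle calls
  (a variable and an index).  A randomized algorithm is a probability distribution on such trees.\<close>

datatype algo = Answer bool | Ask nat nat "cstr option \<Rightarrow> algo"

primrec accepts :: "algo \<Rightarrow> (nat \<Rightarrow> nat \<Rightarrow> cstr option) \<Rightarrow> bool" where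
  "accepts (Answer b) orc = b"
| "accepts (Ask x i f) orc = accepts (f (orc x i)) orc"

primrec num_queries :: "algo \<Rightarrow> (nat \<Rightarrow> nat \<Rightarrow> cstr option) \<Rightarrow> nat" where
  "num_queries (Answer b) orc = 0"
| "num_queries (Ask x i f) orc = Suc (num_queries (f (orc x i)) orc)"

definition is_tester :: "real \<Rightarrow> nat \<Rightarrow> nat \<Rightarrow> nat \<Rightarrow> algo pmf \<Rightarrow> bool" where
  "is_tester \<epsilon> k d n A \<longleftrightarrow>
     (\<forall>I \<in> csp_instances k d n.
        (satisfiable (cstrs I) \<longrightarrow> measure_pmf.prob A {t. accepts t (csp_oracle n I)} \<ge> 2/3) \<and>
        (far_from_sat \<epsilon> k d n I \<longrightarrow> measure_pmf.prob A {t. \<not> accepts t (csp_oracle n I)} \<ge> 2/3))"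

definition makes_at_most :: "nat \<Rightarrow> nat \<Rightarrow> nat \<Rightarrow> algo pmf \<Rightarrow> nat \<Rightarrow> bool" where
  "makes_at_most k d n A q \<longleftrightarrow>
     (\<forall>I \<in> csp_instances k d n. \<forall>t \<in> set_pmf A. num_queries t (csp_oracle n I) \<le> q)"

end

theory Submission
  imports Defs
begin

text \<open>Let \<open>V\<close> be a linear code of length \<open>k\<close> with at most \<open>2 * k\<close> words in which any two positions
  are independent: the words \<open>(\<langle>a, v i\<rangle>)\<^sub>i\<close> for distinct nonzero vectors \<open>v i\<close> over the two-element
  field.  Fix a hypergraph with about \<open>d * n / k\<close> edges and degrees at most \<open>d\<close> in which every set of
  \<open>t \<le> \<gamma> * n\<close> edges covers more than \<open>(k - 3/2) * t\<close> vertices.  The constraint on edge \<open>e\<close> says that the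
  assignment, read along \<open>e\<close> and shifted by a word \<open>s e\<close>, lies in \<open>V\<close>.

  For uniformly random shifts, a Chernoff bound and a union bound over the assignments show that no
  assignment satisfies more than a fraction \<open>2 * k / 2 ^ k + \<epsilon>\<close> of the constraints.  For shifts
  planted as an assignment plus random codewords the instance is satisfiable.  Both kinds of shifts
  are uniform on every set of at most \<open>\<gamma> * n\<close> edges, since by expansion some edge of the set has at most
  two positions that are not private to it: there the codeword takes arbitrary values, and on the
  private positions the assignment does.  So a tree with at most \<open>\<gamma> * n\<close> queries accepts both with the
  same probability.\<close>

section \<open>Small-set expansion\<close>

text \<open>A single term of the series of \<open>exp t\<close> gives
  \<open>t ^ t / fact t \<le> exp t\<close>; this is combined with
  \<open>fact t * (m choose t) \<le> m ^ t\<close>.\<close>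

lemma binomial_le_exp_power:
  assumes "t > 0"
  shows "real (m choose t) \<le> (exp 1 * real m / real t) ^ t"
proof -
  have "real t ^ t / fact t \<le> exp (real t)"
  proof -
    have "(\<Sum>i\<in>{t}. real t ^ i /\<^sub>R fact i) \<le> (\<Sum>i. real t ^ i /\<^sub>R fact i)"
      by (rule sum_le_suminf) (use exp_converges[of "real t"] in \<open>auto simp: sums_iff\<close>)
    also have "\<dots> = exp (real t)"
      using exp_converges[of "real t"] by (simp add: sums_iff)
    finally show ?thesis by (simp add: field_simps)
  qed
  then have *: "real t ^ t \<le> exp 1 ^ t * fact t"
    by (simp add: field_simps flip: exp_of_nat_mult)
  have "real (fact t * (m choose t)) \<le> real (m ^ t)"
    using binomial_fact_pow[of m t] by (metis mult.commute of_nat_mono)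
  then have "fact t * real (m choose t) * real t ^ t \<le> real m ^ t * (exp 1 ^ t * fact t)"
    using * by (intro mult_mono) auto
  then have "real (m choose t) * real t ^ t \<le> real m ^ t * exp 1 ^ t"
    by (simp add: field_simps)
  then show ?thesis
    using assms by (simp add: power_mult_distrib power_divide field_simps)
qed

text \<open>Bounds the expected number of pairs of \<open>t\<close> edges and \<open>v\<close>
  vertices enclosing them in a random hypergraph; \<open>v\<close> is the largest size that violates
  expansion. Since \<open>k * t - v\<close> is at least \<open>3/2 * t\<close>, the power of
  \<open>t / n\<close> wins: squared, \<open>(t / n) ^ (3 * t)\<close> meets
  \<open>(n / t) ^ (2 * t)\<close>, which leaves \<open>(t / n) ^ t\<close> times constants that
  \<open>small\<close> controls.\<close>

lemma union_bound_term:
  fixes d k m n t :: nat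
  assumes k: "k \<ge> 3" and t: "t > 0" and n: "n > 0" and m: "m \<le> n * d" and d: "d > 0"
    and small: "4 * exp (2 * real k + 2) * (real d)\<^sup>2 * real k ^ 3 * real t \<le> real n"
  defines "v \<equiv> (2 * k - 3) * t div 2"
  shows "v \<le> n" "real (m choose t) * real (n choose v) * (real v / real n) ^ (k * t) \<le> (1 / 2) ^ t"
proof -
  have v: "2 * v \<le> (2 * k - 3) * t" "v > 0"
  proof -
    show "2 * v \<le> (2 * k - 3) * t" by (simp add: v_def)
    have "3 * 1 \<le> (2 * k - 3) * t" using k t by (intro mult_mono) auto
    then show "v > 0" unfolding v_def by linarith
  qed
  \<comment> \<open>In other words \<open>3 * t \<le> 2 * (k * t - v)\<close>, the source of the
    exponent \<open>3 * t\<close> of \<open>z\<close> below.\<close>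
  have vk: "2 * v + 3 * t \<le> 2 * (k * t)"
  proof -
    have "(2 * k - 3) * t + 3 * t = (2 * k - 3 + 3) * t" by (simp only: add_mult_distrib)
    also have "\<dots> = 2 * (k * t)" using k by simp
    finally show ?thesis using v(1) by linarith
  qed
  then have vle: "v \<le> k * t" by linarith
  have "real k * real t \<le> 4 * exp (2 * real k + 2) * (real d)\<^sup>2 * real k ^ 3 * real t"
  proof -
    have "1 \<le> exp (2 * real k + 2)" by simp
    moreover have "1 \<le> (real d)\<^sup>2" using d by simp
    moreover have "real k \<le> real k ^ 3" using k by (simp add: self_le_power)
    ultimately have "1 * 1 * 1 * real k * real t \<le> 4 * exp (2 * real k + 2) * (real d)\<^sup>2 * real k ^ 3 * real t"
      by (intro mult_mono) auto
    then show ?thesis by simp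
  qed
  with small have kt: "real k * real t \<le> real n" by linarith
  then have "real (k * t) \<le> real n" by simp
  with vle show vn: "v \<le> n" by linarith
  define y where "y = exp 1 * (real n * real d) / real t"
  define z where "z = real k * real t / real n"
  have z: "0 \<le> z" "z \<le> 1" using kt n by (auto simp: z_def)
  have vz: "real v / real n \<le> z"
    unfolding z_def using vle n by (intro divide_right_mono) (simp_all flip: of_nat_mult)
  have vn': "0 < real v / real n" using v(2) n by simp
  have "real (m choose t) \<le> (exp 1 * real m / real t) ^ t"
    using t by (rule binomial_le_exp_power)
  also have "\<dots> \<le> y ^ t"
    unfolding y_def using m t
    by (intro power_mono divide_right_mono mult_left_mono) (simp_all flip: of_nat_mult)
  finally have a: "real (m choose t) \<le> y ^ t" .
  have "real (n choose v) \<le> (exp 1 * real n / real v) ^ v"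
    using v(2) by (rule binomial_le_exp_power)
  also have "\<dots> = exp 1 ^ v / (real v / real n) ^ v"
    by (simp add: power_divide power_mult_distrib)
  finally have b: "real (n choose v) \<le> exp 1 ^ v / (real v / real n) ^ v" .
  \<comment> \<open>The first factor cancels the denominator in the bound on
    \<open>n choose v\<close>.\<close>
  have split: "(real v / real n) ^ (k * t) = (real v / real n) ^ v * (real v / real n) ^ (k * t - v)"
    using vle by (simp flip: power_add)
  have "real (m choose t) * real (n choose v) * (real v / real n) ^ (k * t)
      \<le> y ^ t * (exp 1 ^ v / (real v / real n) ^ v) * (real v / real n) ^ (k * t)"
    using a b by (intro mult_mono) (auto intro: order_trans[OF _ a])
  also have "\<dots> = y ^ t * exp 1 ^ v * (real v / real n) ^ (k * t - v)"
    unfolding split using vn' v(2) n by simp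
  also have "\<dots> \<le> y ^ t * exp 1 ^ v * z ^ (k * t - v)"
    using vz vn' by (intro mult_left_mono power_mono) (auto simp: y_def)
  finally have c: "real (m choose t) * real (n choose v) * (real v / real n) ^ (k * t)
      \<le> y ^ t * exp 1 ^ v * z ^ (k * t - v)" (is "?x \<le> ?y") .
  \<comment> \<open>Squaring avoids half-integral exponents.\<close>
  have "?x ^ 2 \<le> ?y ^ 2" using c by (intro power_mono) auto
  also have "?y ^ 2 = (y ^ 2) ^ t * exp 1 ^ (2 * v) * z ^ (2 * (k * t - v))"
    by (simp add: power_mult_distrib mult.commute flip: power_mult)
  also have "\<dots> \<le> (y ^ 2) ^ t * exp 1 ^ (2 * (k * t)) * z ^ (3 * t)"
  proof -
    have "(exp 1 :: real) ^ (2 * v) \<le> exp 1 ^ (2 * (k * t))"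
      using vle by (intro power_increasing) auto
    moreover have "z ^ (2 * (k * t - v)) \<le> z ^ (3 * t)"
      using z vk by (intro power_decreasing) auto
    ultimately show ?thesis
      using z by (intro mult_mono) auto
  qed
  also have "\<dots> = (y ^ 2 * exp 1 ^ (2 * k) * z ^ 3) ^ t"
    by (simp add: power_mult_distrib mult_ac flip: power_mult)
  also have "y ^ 2 * exp 1 ^ (2 * k) * z ^ 3
      = exp (2 * real k + 2) * (real d)\<^sup>2 * real k ^ 3 * real t / real n"
  proof -
    have e: "exp (2 * real k + 2) = exp 1 ^ (2 * k) * (exp 1)\<^sup>2"
      by (simp add: exp_add flip: exp_of_nat_mult)
    show ?thesis using t n unfolding y_def z_def e
      by (simp add: field_simps power2_eq_square power3_eq_cube)
  qed
  \<comment> \<open>The factor 4 in \<open>small\<close> is there for this: the square of the bound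
    \<open>(1 / 2) ^ t\<close> is \<open>(1 / 4) ^ t\<close>.\<close>
  also have "(\<dots>) ^ t \<le> (1 / 4) ^ t"
    using small n by (intro power_mono) (auto simp: field_simps)
  also have "(1 / 4 :: real) ^ t = ((1 / 2) ^ t) ^ 2"
    by (simp add: power_even_eq power2_eq_square power_divide flip: power_mult_distrib)
  finally show "?x \<le> (1 / 2) ^ t"
    by (rule power2_le_imp_le) simp
qed

text \<open>A random permutation places the points of \<open>A\<close> one after the other without
  replacement. After \<open>j\<close> points have landed in \<open>W\<close>, the next one does so
  with probability \<open>(card W - j) / (N - j)\<close>, which is at most
  \<open>card W / N\<close>.\<close>

lemma card_permutes_image_subset:
  assumes "A \<subseteq> {..<N}" "W \<subseteq> {..<N}"
  shows "real (card {p. p permutes {..<N} \<and> p ` A \<subseteq> W}) \<le> fact N * (real (card W) / real N) ^ card A"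
proof -
  have "finite A" using assms(1) finite_subset by blast
  then show ?thesis using assms(1)
  proof (induction A rule: finite_induct)
    case empty
    have "card {p. p permutes {..<N}} = fact N" by (rule card_permutations) auto
    then show ?case by simp
  next
    case (insert x A)
    define P where "P B = {p. p permutes {..<N} \<and> p ` B \<subseteq> W}" for B
    have fin: "finite (P B)" for B
      by (rule finite_subset[OF _ finite_permutations[of "{..<N}"]]) (auto simp: P_def)
    have finW: "finite W" using assms(2) finite_subset by blast
    have xN: "x < N" and AN: "A \<subseteq> {..<N}" using insert by auto
    have cA: "card A < N"
      using psubset_card_mono[of "{..<N}" A] insert xN AN by auto
    \<comment> \<open>All points outside \<open>A\<close> are exchangeable: composing with the
      transposition of \<open>x\<close> and \<open>y\<close> fixes \<open>A\<close>
      pointwise.\<close>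
    have same: "card (P (insert y A)) = card (P (insert x A))" if y: "y \<in> {..<N} - A" for y
    proof (rule bij_betw_same_card)
      have perm: "Transposition.transpose x y permutes {..<N}"
        using y xN by (intro permutes_swap_id) auto
      have imA: "Transposition.transpose x y ` A = A"
        using insert(2) y by (auto simp: Transposition.transpose_def image_iff)
      have *: "p \<circ> Transposition.transpose x y \<in> P (insert b A)"
        if "p \<in> P (insert a A)" "Transposition.transpose x y b = a" for p a b
      proof -
        have "(p \<circ> Transposition.transpose x y) ` insert b A = p ` insert (Transposition.transpose x y b) (Transposition.transpose x y ` A)"
          by auto
        also have "\<dots> = p ` insert a A" by (simp only: imA that(2))
        finally have "(p \<circ> Transposition.transpose x y) ` insert b A = p ` insert a A" .
        moreover have "p \<circ> Transposition.transpose x y permutes {..<N}"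
          using that(1) perm by (intro permutes_compose) (auto simp: P_def)
        ultimately show ?thesis using that(1) by (simp only: P_def mem_Collect_eq)
      qed
      show "bij_betw (\<lambda>p. p \<circ> Transposition.transpose x y) (P (insert y A)) (P (insert x A))"
      proof (rule bij_betw_byWitness[where f' = "\<lambda>p. p \<circ> Transposition.transpose x y"])
        show "(\<lambda>p. p \<circ> Transposition.transpose x y) ` P (insert y A) \<subseteq> P (insert x A)"
          using *[of _ y x] by (auto simp del: o_apply)
        show "(\<lambda>p. p \<circ> Transposition.transpose x y) ` P (insert x A) \<subseteq> P (insert y A)"
          using *[of _ x y] by (auto simp del: o_apply)
      qed (simp_all add: o_assoc[symmetric])
    qed
    have le: "card A \<le> card W" if "p \<in> P A" for p
    proof -
      have "p permutes {..<N}" "p ` A \<subseteq> W" using that by (auto simp: P_def)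
      then show ?thesis using card_image[of p A] card_mono[OF finW] permutes_inj_on by metis
    qed
    have count: "card {y \<in> {..<N} - A. p y \<in> W} = card W - card A" if p: "p \<in> P A" for p
    proof -
      have pp: "p permutes {..<N}" and pA: "p ` A \<subseteq> W" using p by (auto simp: P_def)
      have inj: "inj_on p S" for S using pp by (rule permutes_inj_on)
      have "p ` {y \<in> {..<N} - A. p y \<in> W} = W - p ` A"
      proof
        show "p ` {y \<in> {..<N} - A. p y \<in> W} \<subseteq> W - p ` A"
          using permutes_inj[OF pp] by (auto simp: inj_eq)
        show "W - p ` A \<subseteq> p ` {y \<in> {..<N} - A. p y \<in> W}"
        proof
          fix w assume w: "w \<in> W - p ` A"
          then have "w \<in> p ` {..<N}" using permutes_image[OF pp] assms(2) by auto
          then obtain y where "y < N" "w = p y" by auto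
          with w show "w \<in> p ` {y \<in> {..<N} - A. p y \<in> W}" by auto
        qed
      qed
      then have "card {y \<in> {..<N} - A. p y \<in> W} = card (W - p ` A)"
        using card_image[OF inj] by metis
      also have "\<dots> = card W - card (p ` A)"
        using insert(1) pA by (intro card_Diff_subset) auto
      finally show ?thesis by (simp add: card_image[OF inj])
    qed
    \<comment> \<open>Double counting of the pairs of a permutation in \<open>P A\<close> and a
      point outside \<open>A\<close> that it maps into \<open>W\<close>.\<close>
    have "(N - card A) * card (P (insert x A)) = (\<Sum>y\<in>{..<N} - A. card (P (insert x A)))"
      using AN insert(1) by (simp add: card_Diff_subset)
    also have "\<dots> = (\<Sum>y\<in>{..<N} - A. card {p \<in> P A. p y \<in> W})"
    proof (rule sum.cong)
      fix y assume "y \<in> {..<N} - A"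
      from same[OF this] show "card (P (insert x A)) = card {p \<in> P A. p y \<in> W}"
        by (simp add: P_def conj_ac)
    qed auto
    also have "\<dots> = (\<Sum>p\<in>P A. card {y \<in> {..<N} - A. p y \<in> W})"
      by (rule sum_multicount_gen) (use fin in auto)
    also have "\<dots> = card (P A) * (card W - card A)"
      using count by simp
    finally have eq: "(N - card A) * card (P (insert x A)) = card (P A) * (card W - card A)" .
    have "real N * real (card (P (insert x A))) \<le> real (card (P A)) * real (card W)"
    proof (cases "P A = {}")
      case True
      then have "card (P (insert x A)) = 0" using eq cA by simp
      then show ?thesis by simp
    next
      case False
      then have cAW: "card A \<le> card W" using le by blast
      have WN: "card W \<le> N" using card_mono[OF _ assms(2)] by simp
      have "real (N - card A) * (real N * real (card (P (insert x A))))
          = real N * (real (card (P A)) * real (card W - card A))"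
        using eq by (metis (no_types, lifting) mult.left_commute of_nat_mult)
      also have "\<dots> = real (card (P A)) * (real N * (real (card W) - real (card A)))"
        using cAW by (simp add: of_nat_diff)
      also have "\<dots> \<le> real (card (P A)) * ((real N - real (card A)) * real (card W))"
        using mult_right_mono[of "real (card W)" "real N" "real (card A)"] WN
        by (intro mult_left_mono) (simp_all add: algebra_simps)
      also have "\<dots> = real (N - card A) * (real (card (P A)) * real (card W))"
        using cA by (simp add: of_nat_diff)
      finally show ?thesis using cA by simp
    qed
    then have "real (card (P (insert x A))) \<le> real (card (P A)) * (real (card W) / real N)"
      using xN by (simp add: field_simps)
    also have "\<dots> \<le> (fact N * (real (card W) / real N) ^ card A) * (real (card W) / real N)"
      using insert.IH AN by (intro mult_right_mono) (auto simp: P_def)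
    finally show ?case using insert by (simp add: P_def mult_ac)
  qed
qed

text \<open>The factor \<open>k - 3/2\<close> is doubled to stay in the natural numbers.
  \<open>h e i\<close> is the vertex in slot \<open>i\<close> of edge \<open>e\<close>; an edge may
  repeat a vertex, so only distinct vertices are counted.\<close>

definition expanding :: "nat \<Rightarrow> nat \<Rightarrow> (nat \<Rightarrow> nat \<Rightarrow> nat) \<Rightarrow> nat \<Rightarrow> bool" where
  "expanding k m h q \<longleftrightarrow>
     (\<forall>S \<subseteq> {..<m}. S \<noteq> {} \<longrightarrow> card S \<le> q \<longrightarrow>
        (2 * k - 3) * card S < 2 * card (\<Union>e\<in>S. h e ` {..<k}))"

lemma card_mod_fiber_le:
  assumes "finite W"
  shows "card {y. y < n * d \<and> y mod n \<in> W} \<le> card W * (d :: nat)"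
proof -
  have "{y. y < n * d \<and> y mod n \<in> W} \<subseteq> (\<lambda>(x, c). x + n * c) ` (W \<times> {..<d})"
  proof
    fix y assume y: "y \<in> {y. y < n * d \<and> y mod n \<in> W}"
    then have "y div n < d" by (auto simp: less_mult_imp_div_less mult.commute)
    moreover have "y = y mod n + n * (y div n)" by simp
    ultimately show "y \<in> (\<lambda>(x, c). x + n * c) ` (W \<times> {..<d})"
      using y by (intro image_eqI[of _ _ "(y mod n, y div n)"]) auto
  qed
  then have "card {y. y < n * d \<and> y mod n \<in> W} \<le> card ((\<lambda>(x, c). x + n * c) ` (W \<times> {..<d}))"
    using assms by (intro card_mono) auto
  also have "\<dots> \<le> card (W \<times> {..<d})" using assms by (intro card_image_le) auto
  finally show ?thesis by (simp add: card_cartesian_product)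
qed

lemma sum_half_powers: "(\<Sum>t = 1..q. (1 / 2 :: real) ^ t) < 1"
proof -
  have "(\<Sum>t = 1..q. (1 / 2 :: real) ^ t) = 1 - (1 / 2) ^ q"
    by (induction q) (auto simp: field_simps)
  then show ?thesis by simp
qed

text \<open>Configuration model: a uniformly random permutation of the \<open>n * d\<close> half-edges matches slot
  \<open>i\<close> of edge \<open>e\<close>, numbered \<open>e * k + i\<close>, with a half-edge \<open>y\<close> of the variable \<open>y mod n\<close>.\<close>

lemma ex_expanding:
  fixes d k n q :: nat
  assumes k: "k \<ge> 3" and d: "d > 0" and n: "n > 0"
    and q: "4 * exp (2 * real k + 2) * (real d)\<^sup>2 * real k ^ 3 * real q \<le> real n"
  defines "m \<equiv> n * d div k"
  shows "\<exists>h. (\<forall>e i. h e i < n) \<and> (\<forall>x. card {e. e < m \<and> x \<in> h e ` {..<k}} \<le> d) \<and> expanding k m h q"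
proof -
  define N where "N = n * d"
  have mk: "m * k \<le> N" by (simp add: m_def N_def)
  have mN: "m \<le> N" unfolding m_def N_def by simp
  define slots where "slots S = (\<lambda>(e, i). e * k + i) ` (S \<times> {..<k})" for S
  have slot_less: "e * k + i < N" if "e < m" "i < k" for e i
  proof -
    have "e * k + i < e * k + k" using that by simp
    also have "\<dots> = (e + 1) * k" by simp
    also have "\<dots> \<le> m * k" using that by (intro mult_right_mono) auto
    finally show ?thesis using mk by simp
  qed
  have slots_sub: "slots S \<subseteq> {..<N}" if "S \<subseteq> {..<m}" for S
    using that slot_less by (auto simp: slots_def)
  have card_slots: "card (slots S) = k * card S" if "S \<subseteq> {..<m}" for S
  proof -
    have "inj_on (\<lambda>(e, i). e * k + i) (S \<times> {..<k})"
    proof (rule inj_onI, clarsimp)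
      fix a b a' b' assume *: "b < k" "b' < k" "a * k + b = a' * k + b'"
      from *(3) have "(a * k + b) div k = (a' * k + b') div k" "(a * k + b) mod k = (a' * k + b') mod k"
        by simp_all
      with *(1,2) show "a = a' \<and> b = b'" by simp
    qed
    then show ?thesis by (simp add: slots_def card_image card_cartesian_product)
  qed
  define h where "h p e i = p (e * k + i) mod n" for p :: "nat \<Rightarrow> nat" and e i
  define fiber where "fiber W = {y. y < N \<and> y mod n \<in> W}" for W
  define Bad where "Bad S W = {p. p permutes {..<N} \<and> p ` slots S \<subseteq> fiber W}" for S W
  define v where "v t = (2 * k - 3) * t div 2" for t
  define SS where "SS t = {S. S \<subseteq> {..<m} \<and> card S = t}" for t
  define WW where "WW t = {W. W \<subseteq> {..<n} \<and> card W = v t}" for t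
  have fin: "finite (SS t)" "finite (WW t)" for t
    by (auto simp: SS_def WW_def)
  have deg: "card {e. e < m \<and> x \<in> h p e ` {..<k}} \<le> d" if p: "p permutes {..<N}" for p x
  proof -
    have "{e. e < m \<and> x \<in> h p e ` {..<k}} \<subseteq> (\<lambda>j. j div k) ` {j. j < N \<and> p j mod n = x}"
    proof clarsimp
      fix e i assume "e < m" "i < k" "x = h p e i"
      then show "e \<in> (\<lambda>j. j div k) ` {j. j < N \<and> p j mod n = h p e i}"
        using slot_less by (intro image_eqI[of _ _ "e * k + i"]) (auto simp: h_def)
    qed
    then have "card {e. e < m \<and> x \<in> h p e ` {..<k}} \<le> card ((\<lambda>j. j div k) ` {j. j < N \<and> p j mod n = x})"
      by (intro card_mono) auto
    also have "\<dots> \<le> card {j. j < N \<and> p j mod n = x}"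
      by (intro card_image_le) auto
    also have "\<dots> = card (p ` {j. j < N \<and> p j mod n = x})"
      using permutes_inj_on[OF p] by (simp add: card_image)
    also have "\<dots> \<le> card {y. y < n * d \<and> y mod n \<in> {x}}"
      using permutes_in_image[OF p] by (intro card_mono) (auto simp: N_def)
    also have "\<dots> \<le> d" using card_mod_fiber_le[of "{x}" n d] by simp
    finally show ?thesis .
  qed
  have bad: "real (card (Bad S W)) \<le> fact N * (real (v t) / real n) ^ (k * t)"
    if "S \<in> SS t" "W \<in> WW t" for S W t
  proof -
    have S: "S \<subseteq> {..<m}" "card S = t" using that(1) by (auto simp: SS_def)
    have W: "finite W" "card W = v t" using that(2) finite_subset by (auto simp: WW_def)
    have "real (card (Bad S W)) \<le> fact N * (real (card (fiber W)) / real N) ^ card (slots S)"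
      unfolding Bad_def using slots_sub[OF S(1)]
      by (intro card_permutes_image_subset) (auto simp: fiber_def)
    also have "\<dots> \<le> fact N * ((real (v t) * real d) / real N) ^ card (slots S)"
    proof -
      have "card (fiber W) \<le> v t * d"
        using card_mod_fiber_le[OF W(1), of n d] W(2) by (simp add: fiber_def N_def)
      then have "real (card (fiber W)) \<le> real (v t) * real d" by (simp flip: of_nat_mult)
      then show ?thesis by (intro mult_left_mono power_mono divide_right_mono) auto
    qed
    also have "\<dots> = fact N * (real (v t) / real n) ^ (k * t)"
      using d by (simp add: N_def card_slots[OF S(1)] S(2))
    finally show ?thesis .
  qed
  have "\<exists>p. p permutes {..<N} \<and> expanding k m (h p) q"
  proof (rule ccontr)
    assume contra: "\<not> ?thesis"
    have cover: "{p. p permutes {..<N}} \<subseteq> (\<Union>t\<in>{1..q}. \<Union>S\<in>SS t. \<Union>W\<in>WW t. Bad S W)"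
    proof
      fix p assume p: "p \<in> {p. p permutes {..<N}}"
      with contra obtain S where S: "S \<subseteq> {..<m}" "S \<noteq> {}" "card S \<le> q"
        "2 * card (\<Union>e\<in>S. h p e ` {..<k}) \<le> (2 * k - 3) * card S"
        unfolding expanding_def by (auto simp: not_less)
      define t where "t = card S"
      have t: "t \<ge> 1" "t \<le> q" using S finite_subset[of S "{..<m}"] by (auto simp: t_def Suc_le_eq card_gt_0_iff)
      let ?I = "\<Union>e\<in>S. h p e ` {..<k}"
      have "4 * exp (2 * real k + 2) * (real d)\<^sup>2 * real k ^ 3 * real t
          \<le> 4 * exp (2 * real k + 2) * (real d)\<^sup>2 * real k ^ 3 * real q"
        using t by (intro mult_left_mono) auto
      then have "4 * exp (2 * real k + 2) * (real d)\<^sup>2 * real k ^ 3 * real t \<le> real n"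
        using q by linarith
      then have "v t \<le> n"
        unfolding v_def using t k n d mN by (intro union_bound_term(1)[where d = d and m = m]) (auto simp: N_def)
      moreover have "card ?I \<le> v t" using S(4) by (simp add: v_def t_def)
      moreover have "?I \<subseteq> {..<n}" using n by (auto simp: h_def)
      \<comment> \<open>The covered set is enlarged to exactly \<open>v t\<close> vertices, so that
        the union bound runs over sets of one size for each \<open>t\<close>.\<close>
      ultimately obtain W where W: "?I \<subseteq> W" "W \<subseteq> {..<n}" "card W = v t"
        using exists_subset_between[of ?I "v t" "{..<n}"] by auto
      have "p \<in> Bad S W"
        using p slots_sub[OF S(1)] permutes_in_image[of p "{..<N}"] W(1)
        by (fastforce simp: Bad_def fiber_def slots_def h_def)
      moreover have "S \<in> SS t" "W \<in> WW t" using S(1) W(2,3) by (simp_all add: SS_def WW_def t_def)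
      ultimately show "p \<in> (\<Union>t\<in>{1..q}. \<Union>S\<in>SS t. \<Union>W\<in>WW t. Bad S W)"
        using t by (intro UN_I[of t] UN_I[of S] UN_I[of W]) auto
    qed
    have finBad: "finite (Bad S W)" for S W
      by (rule finite_subset[OF _ finite_permutations[of "{..<N}"]]) (auto simp: Bad_def)
    have "fact N = card {p. p permutes {..<N}}"
      by (subst card_permutations) auto
    also have "\<dots> \<le> card (\<Union>t\<in>{1..q}. \<Union>S\<in>SS t. \<Union>W\<in>WW t. Bad S W)"
      using cover fin finBad by (intro card_mono) auto
    also have "\<dots> \<le> (\<Sum>t = 1..q. \<Sum>S\<in>SS t. \<Sum>W\<in>WW t. card (Bad S W))"
      using fin by (intro order_trans[OF card_UN_le] sum_mono) auto
    finally have "real (fact N) \<le> real (\<Sum>t = 1..q. \<Sum>S\<in>SS t. \<Sum>W\<in>WW t. card (Bad S W))"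
      by (rule of_nat_mono)
    also have "\<dots> \<le> (\<Sum>t = 1..q. \<Sum>S\<in>SS t. \<Sum>W\<in>WW t. fact N * (real (v t) / real n) ^ (k * t))"
      unfolding of_nat_sum by (intro sum_mono bad)
    also have "\<dots> = (\<Sum>t = 1..q. fact N * (real (m choose t) * real (n choose v t) * (real (v t) / real n) ^ (k * t)))"
      by (simp add: SS_def WW_def n_subsets algebra_simps)
    also have "\<dots> \<le> (\<Sum>t = 1..q. fact N * (1 / 2) ^ t)"
    proof (intro sum_mono mult_left_mono)
      fix t assume t: "t \<in> {1..q}"
      have "4 * exp (2 * real k + 2) * (real d)\<^sup>2 * real k ^ 3 * real t
          \<le> 4 * exp (2 * real k + 2) * (real d)\<^sup>2 * real k ^ 3 * real q"
        using t by (intro mult_left_mono) auto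
      then have "4 * exp (2 * real k + 2) * (real d)\<^sup>2 * real k ^ 3 * real t \<le> real n"
        using q by linarith
      then show "real (m choose t) * real (n choose v t) * (real (v t) / real n) ^ (k * t) \<le> (1 / 2) ^ t"
        unfolding v_def using t k n d mN by (intro union_bound_term(2)[where d = d]) (auto simp: N_def)
    qed auto
    also have "\<dots> < fact N"
      using sum_half_powers[of q] by (simp flip: sum_distrib_left)
    finally show False by simp
  qed
  then obtain p where "p permutes {..<N}" "expanding k m (h p) q" by blast
  moreover have "\<forall>e i. h p e i < n" using n by (simp add: h_def)
  ultimately show ?thesis using deg by blast
qed

text \<open>A vertex that is not private to one slot uses at least two slots, so twice the number of
  vertices is at most the number of slots plus the number of private slots. Expansion then leaves
  more than \<open>k - 3\<close> private slots per edge on average, and some edge has at least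
  \<open>k - 2\<close>.\<close>

lemma expanding_peel:
  assumes k: "k \<ge> 3" and ex: "expanding k m h q" and Q: "Q \<subseteq> {..<m}" "Q \<noteq> {}" "card Q \<le> q"
  obtains e i0 j0 where "e \<in> Q" "i0 < k" "j0 < k" "i0 \<noteq> j0"
    "\<And>i e' i'. i < k \<Longrightarrow> i \<noteq> i0 \<Longrightarrow> i \<noteq> j0 \<Longrightarrow> e' \<in> Q \<Longrightarrow> i' < k \<Longrightarrow> h e' i' = h e i \<Longrightarrow> e' = e \<and> i' = i"
proof -
  have finQ: "finite Q" using Q(1) finite_subset by blast
  define X where "X = Q \<times> {..<k}"
  define f where "f = (\<lambda>(e, i). h e i)"
  have finX: "finite X" using finQ by (simp add: X_def)
  define F where "F w = {s \<in> X. f s = w}" for w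
  have finF: "finite (F w)" for w using finX by (simp add: F_def)
  \<comment> \<open>\<open>U\<close> consists of the private slots: no other slot of an edge in
    \<open>Q\<close> holds the same vertex.\<close>
  define U where "U = {s \<in> X. \<forall>s'\<in>X. f s' = f s \<longrightarrow> s' = s}"
  have UX: "U \<subseteq> X" by (auto simp: U_def)
  then have finU: "finite U" using finX finite_subset by blast
  have W: "f ` X = (\<Union>e\<in>Q. h e ` {..<k})" by (force simp: X_def f_def)
  have card_X: "card X = k * card Q" by (simp add: X_def card_cartesian_product)
  have "2 * card (f ` X) = (\<Sum>w\<in>f ` X. 2)" by simp
  also have "\<dots> \<le> (\<Sum>w\<in>f ` X. card (F w) + (if card (F w) = 1 then 1 else 0))"
  proof (rule sum_mono)
    fix w assume "w \<in> f ` X"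
    then have "F w \<noteq> {}" by (auto simp: F_def)
    then have "card (F w) > 0" using finF by (simp add: card_gt_0_iff)
    then show "2 \<le> card (F w) + (if card (F w) = 1 then 1 else 0)" by auto
  qed
  also have "\<dots> = card X + card {w \<in> f ` X. card (F w) = 1}"
    using sum.image_gen[OF finX, of "\<lambda>_. 1::nat" f] finX
    by (simp add: sum.distrib F_def flip: sum.inter_filter)
  also have "card {w \<in> f ` X. card (F w) = 1} \<le> card (f ` U)"
  proof (intro card_mono subsetI)
    fix w assume "w \<in> {w \<in> f ` X. card (F w) = 1}"
    then obtain s where s: "F w = {s}" by (auto simp: card_1_singleton_iff)
    then have "s \<in> F w" by simp
    then have "s \<in> X" "f s = w" by (auto simp: F_def)
    moreover have "s' = s" if "s' \<in> X" "f s' = w" for s'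
      using that s by (auto simp: F_def)
    ultimately show "w \<in> f ` U" by (auto simp: U_def)
  qed (use finU in auto)
  also have "card (f ` U) \<le> card U" using finU by (rule card_image_le)
  finally have "2 * card (f ` X) \<le> k * card Q + card U" by (simp add: card_X)
  moreover have "(2 * k - 3) * card Q < 2 * card (f ` X)"
    using ex Q by (auto simp: expanding_def W)
  moreover have "(2 * k - 3) * card Q = (k - 3) * card Q + k * card Q"
  proof -
    have "2 * k - 3 = k - 3 + k" using k by simp
    then show ?thesis by (simp only: add_mult_distrib)
  qed
  ultimately have U_large: "(k - 3) * card Q < card U" by linarith
  define u where "u e = {i \<in> {..<k}. (e, i) \<in> U}" for e
  have "\<exists>e\<in>Q. k - 3 < card (u e)"
  proof (rule ccontr)
    assume "\<not> ?thesis"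
    then have le: "card (u e) \<le> k - 3" if "e \<in> Q" for e using that by (auto simp: not_less)
    have "U = Sigma Q u" using UX by (auto simp: u_def X_def)
    moreover have "\<forall>e\<in>Q. finite (u e)" by (simp add: u_def)
    ultimately have "card U = (\<Sum>e\<in>Q. card (u e))"
      using finQ card_SigmaI by metis
    also have "\<dots> \<le> (\<Sum>e\<in>Q. k - 3)" using le by (rule sum_mono)
    finally show False using U_large by (simp add: mult.commute)
  qed
  then obtain e where e: "e \<in> Q" "k - 3 < card (u e)" by blast
  have "card ({..<k} - u e) = k - card (u e)"
    by (subst card_Diff_subset) (auto simp: u_def)
  then have "card ({..<k} - u e) \<le> 2" using e(2) by linarith
  \<comment> \<open>The non-private slots are padded to exactly two.\<close>
  then obtain B where B: "{..<k} - u e \<subseteq> B" "B \<subseteq> {..<k}" "card B = 2"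
    using exists_subset_between[of "{..<k} - u e" 2 "{..<k}"] k by auto
  then obtain i0 j0 where ij: "B = {i0, j0}" "i0 \<noteq> j0" by (auto simp: card_2_iff)
  show thesis
  proof (rule that[of e i0 j0])
    fix i e' i' assume *: "i < k" "i \<noteq> i0" "i \<noteq> j0" "e' \<in> Q" "i' < k" "h e' i' = h e i"
    then have "i \<in> u e" using B(1) ij by auto
    then have "(e, i) \<in> U" by (simp add: u_def)
    with * show "e' = e \<and> i' = i" by (fastforce simp: U_def X_def f_def)
  qed (use e B ij in auto)
qed

section \<open>Planted instances\<close>

text \<open>The parity of \<open>card (a \<inter> x)\<close> is the inner product of indicator
  vectors over the two-element field; it is additive in \<open>a\<close>.\<close>

lemma odd_card_sym_diff:
  assumes "finite x"
  shows "odd (card (sym_diff a b \<inter> x)) \<longleftrightarrow> odd (card (a \<inter> x)) \<noteq> odd (card (b \<inter> x))"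
proof -
  let ?A = "a \<inter> x" and ?B = "b \<inter> x"
  have fin: "finite ?A" "finite ?B" using assms by auto
  have "sym_diff a b \<inter> x = (?A - ?B) \<union> (?B - ?A)" by auto
  then have "card (sym_diff a b \<inter> x) = card (?A - ?B) + card (?B - ?A)"
    using fin by (simp only:) (rule card_Un_disjoint, auto)
  moreover have "card ?A = card (?A - ?B) + card (?A \<inter> ?B)"
    using fin by (metis card_Diff_subset_Int card_mono finite_Int inf_le1 le_add_diff_inverse2)
  moreover have "card ?B = card (?B - ?A) + card (?A \<inter> ?B)"
    using fin by (metis Int_commute card_Diff_subset_Int card_mono finite_Int inf_le1 le_add_diff_inverse2)
  ultimately show ?thesis by presburger
qed

text \<open>Distinct nonzero vectors over the two-element field are linearly independent, so their
  functionals jointly take all pairs of values. Concretely, \<open>w\<close> settles the parity on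
  one set, and \<open>z\<close>, which lies only in the other set, then corrects the other
  parity.\<close>

lemma ex_parities:
  assumes "x \<noteq> {}" "y \<noteq> {}" "x \<noteq> y"
  shows "\<exists>a \<subseteq> x \<union> y. odd (card (a \<inter> x)) = b \<and> odd (card (a \<inter> y)) = c"
proof -
  have *: "\<exists>a \<subseteq> x \<union> y. odd (card (a \<inter> x)) = b \<and> odd (card (a \<inter> y)) = c"
    if "z \<in> x" "z \<notin> y" "w \<in> y" for x y :: "'a set" and z w b c
  proof -
    have zw: "z \<noteq> w" using that by auto
    show ?thesis
    proof -
      have 1: "card ({z} \<inter> x) = 1" "card ({z} \<inter> y) = 0" "card ({w} \<inter> y) = 1" "card ({z, w} \<inter> y) = 1"
        using that by auto
      have 2: "card ({w} \<inter> x) = (if w \<in> x then 1 else 0)" "card ({z, w} \<inter> x) = (if w \<in> x then 2 else 1)"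
        using that zw by auto
      define a where "a = (if c then (if (w \<in> x) = b then {w} else {z, w}) else (if b then {z} else {}))"
      have "odd (card (a \<inter> x)) = b \<and> odd (card (a \<inter> y)) = c"
        using 1 2 by (cases b; cases c; cases "w \<in> x") (auto simp: a_def)
      moreover have "a \<subseteq> x \<union> y" using that by (auto simp: a_def)
      ultimately show ?thesis by blast
    qed
  qed
  show ?thesis
  proof (cases "x \<subseteq> y")
    case True
    then obtain z where "z \<in> y" "z \<notin> x" using assms by auto
    moreover obtain w where "w \<in> x" using assms by auto
    ultimately show ?thesis using *[of z y x w c b] by (auto simp: Un_commute)
  next
    case False
    then obtain z where "z \<in> x" "z \<notin> y" by auto
    moreover obtain w where "w \<in> y" using assms by auto
    ultimately show ?thesis using *[of z x y w b c] by auto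
  qed
qed

text \<open>Words of length \<open>k\<close> are represented by the set of their positions with bit 1.\<close>

definition planted :: "nat \<Rightarrow> (nat \<Rightarrow> nat set) \<Rightarrow> (nat \<Rightarrow> nat \<Rightarrow> nat) \<Rightarrow> nat set \<times> (nat \<Rightarrow> nat set) \<Rightarrow> nat \<Rightarrow> nat set" where
  "planted k v h \<omega> e = {i. i < k \<and> (h e i \<in> fst \<omega>) \<noteq> odd (card (snd \<omega> e \<inter> v i))}"

text \<open>Induction on \<open>Q\<close>, removing an edge \<open>e\<close> with at most two shared
  positions. After the other edges are settled, the codeword at \<open>e\<close> is chosen to be
  right at these two positions, and the assignment is changed at the private positions, where no
  other edge of \<open>Q\<close> sees it.\<close>

lemma planted_surj:
  assumes k: "k \<ge> 3" and ex: "expanding k m h q" and hn: "\<And>e i. h e i < n"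
    and v: "inj_on v {..<k}" "\<And>i. i < k \<Longrightarrow> v i \<subseteq> {..<r}" "\<And>i. i < k \<Longrightarrow> v i \<noteq> {}"
    and "Q \<subseteq> {..<m}" "card Q \<le> q" "\<And>e. e \<in> Q \<Longrightarrow> \<tau> e \<subseteq> {..<k}"
  shows "\<exists>\<sigma> a. \<sigma> \<subseteq> {..<n} \<and> (\<forall>e. a e \<subseteq> {..<r}) \<and> (\<forall>e\<in>Q. planted k v h (\<sigma>, a) e = \<tau> e)"
  using assms(7-)
proof (induction "card Q" arbitrary: Q)
  case 0
  then have "Q = {}" using finite_subset[of Q "{..<m}"] by auto
  then show ?case by auto
next
  case (Suc c)
  have finQ: "finite Q" using Suc.prems(1) finite_subset by blast
  have "Q \<noteq> {}" using Suc.hyps(2) by auto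
  then obtain e i0 j0 where e: "e \<in> Q" and ij: "i0 < k" "j0 < k" "i0 \<noteq> j0"
    and fresh: "\<And>i e' i'. i < k \<Longrightarrow> i \<noteq> i0 \<Longrightarrow> i \<noteq> j0 \<Longrightarrow> e' \<in> Q \<Longrightarrow> i' < k \<Longrightarrow> h e' i' = h e i \<Longrightarrow> e' = e \<and> i' = i"
    using expanding_peel[OF k ex Suc.prems(1) _ Suc.prems(2)] by metis
  have cardQ': "c = card (Q - {e})" using Suc.hyps(2) e finQ by simp
  have "\<exists>\<sigma> a. \<sigma> \<subseteq> {..<n} \<and> (\<forall>e. a e \<subseteq> {..<r}) \<and> (\<forall>e'\<in>Q - {e}. planted k v h (\<sigma>, a) e' = \<tau> e')"
    by (rule Suc.hyps(1)[OF cardQ']) (use Suc.prems Suc.hyps(2) cardQ' in auto)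
  then obtain \<sigma> a where IH: "\<sigma> \<subseteq> {..<n}" "\<And>e. a e \<subseteq> {..<r}"
    "\<And>e'. e' \<in> Q - {e} \<Longrightarrow> planted k v h (\<sigma>, a) e' = \<tau> e'" by blast
  \<comment> \<open>The codeword given by \<open>b\<close> corrects the present assignment at the
    two positions that may be shared.\<close>
  have "v i0 \<noteq> v j0" using v(1) ij by (auto simp: inj_on_def)
  then obtain b where b: "b \<subseteq> v i0 \<union> v j0"
    "odd (card (b \<inter> v i0)) = ((i0 \<in> \<tau> e) \<noteq> (h e i0 \<in> \<sigma>))"
    "odd (card (b \<inter> v j0)) = ((j0 \<in> \<tau> e) \<noteq> (h e j0 \<in> \<sigma>))"
    using ex_parities[of "v i0" "v j0" "(i0 \<in> \<tau> e) \<noteq> (h e i0 \<in> \<sigma>)" "(j0 \<in> \<tau> e) \<noteq> (h e j0 \<in> \<sigma>)"] v(3) ij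
    by blast
  have br: "b \<subseteq> {..<r}" using b(1) v(2) ij by blast
  define F where "F = {i. i < k \<and> i \<noteq> i0 \<and> i \<noteq> j0}"
  \<comment> \<open>On the private vertices of \<open>e\<close> the old value is discarded and the
    value forced by \<open>b\<close> and \<open>\<tau> e\<close> is written.\<close>
  define \<sigma>' where "\<sigma>' = (\<sigma> - h e ` F) \<union> h e ` {i \<in> F. (i \<in> \<tau> e) \<noteq> odd (card (b \<inter> v i))}"
  have on_fresh: "h e i \<in> \<sigma>' \<longleftrightarrow> (i \<in> \<tau> e) \<noteq> odd (card (b \<inter> v i))" if "i \<in> F" for i
    using that fresh e unfolding \<sigma>'_def F_def by blast
  have off_fresh: "h e' i \<in> \<sigma>' \<longleftrightarrow> h e' i \<in> \<sigma>" if "e' \<in> Q" "i < k" "e' \<noteq> e \<or> i \<notin> F" for e' i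
    using that fresh unfolding \<sigma>'_def F_def by blast
  have "planted k v h (\<sigma>', a(e := b)) e' = \<tau> e'" if "e' \<in> Q" for e'
  proof (cases "e' = e")
    case False
    then have "planted k v h (\<sigma>', a(e := b)) e' = planted k v h (\<sigma>, a) e'"
      using off_fresh[OF that] unfolding planted_def by auto
    then show ?thesis using IH(3) that False by simp
  next
    case True
    have "(h e i \<in> \<sigma>') \<noteq> odd (card (b \<inter> v i)) \<longleftrightarrow> i \<in> \<tau> e" if "i < k" for i
    proof (cases "i \<in> F")
      case True
      then show ?thesis using on_fresh by auto
    next
      case False
      with that have "i = i0 \<or> i = j0" by (auto simp: F_def)
      then show ?thesis using off_fresh[OF e that] False b by auto
    qed
    then show ?thesis using Suc.prems(3)[OF e] True unfolding planted_def by auto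
  qed
  moreover have "\<sigma>' \<subseteq> {..<n}" using IH(1) hn by (auto simp: \<sigma>'_def)
  moreover have "\<forall>e'. (a(e := b)) e' \<subseteq> {..<r}" using IH(2) br by simp
  ultimately show ?case by blast
qed

section \<open>Indistinguishability by decision trees\<close>

text \<open>The event that the edges in \<open>Q\<close> have revealed the shifts
  \<open>\<tau>\<close>. All spaces carry the uniform distribution, so events are compared by
  cardinality.\<close>

definition agree :: "'w set \<Rightarrow> ('w \<Rightarrow> nat \<Rightarrow> 'v) \<Rightarrow> nat set \<Rightarrow> (nat \<Rightarrow> 'v) \<Rightarrow> 'w set" where
  "agree \<Omega> S Q \<tau> = {\<omega> \<in> \<Omega>. \<forall>e\<in>Q. S \<omega> e = \<tau> e}"

lemma card_agree_uniform:
  assumes fin: "finite \<Omega>" "finite Q" "finite U"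
    and S: "\<And>\<omega> e. \<omega> \<in> \<Omega> \<Longrightarrow> e \<in> Q \<Longrightarrow> S \<omega> e \<in> U"
    and le: "\<And>\<tau> \<tau>'. \<lbrakk>\<forall>e\<in>Q. \<tau> e \<in> U; \<forall>e\<in>Q. \<tau>' e \<in> U\<rbrakk>
      \<Longrightarrow> card (agree \<Omega> S Q \<tau>) \<le> card (agree \<Omega> S Q \<tau>')"
    and \<tau>: "\<forall>e\<in>Q. \<tau> e \<in> U"
  shows "card \<Omega> = card U ^ card Q * card (agree \<Omega> S Q \<tau>)"
proof -
  let ?T = "PiE Q (\<lambda>_. U)"
  have "card \<Omega> = (\<Sum>\<omega>\<in>\<Omega>. 1)" by simp
  also have "\<dots> = (\<Sum>\<tau>'\<in>?T. \<Sum>\<omega>\<in>{\<omega> \<in> \<Omega>. restrict (S \<omega>) Q = \<tau>'}. 1)"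
    by (rule sum.group[symmetric]) (use fin S in \<open>auto intro!: finite_PiE\<close>)
  also have "\<dots> = (\<Sum>\<tau>'\<in>?T. card (agree \<Omega> S Q \<tau>))"
  proof (rule sum.cong)
    fix \<tau>' assume \<tau>': "\<tau>' \<in> ?T"
    then have "restrict (S \<omega>) Q = \<tau>' \<longleftrightarrow> (\<forall>e\<in>Q. S \<omega> e = \<tau>' e)" for \<omega>
      by (metis PiE_restrict restrict_apply' restrict_ext)
    then have "{\<omega> \<in> \<Omega>. restrict (S \<omega>) Q = \<tau>'} = agree \<Omega> S Q \<tau>'"
      by (simp add: agree_def)
    moreover have "card (agree \<Omega> S Q \<tau>') = card (agree \<Omega> S Q \<tau>)"
      using \<tau> \<tau>' by (intro antisym le) auto
    ultimately show "(\<Sum>\<omega>\<in>{\<omega> \<in> \<Omega>. restrict (S \<omega>) Q = \<tau>'}. 1) = card (agree \<Omega> S Q \<tau>)"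
      by simp
  qed auto
  finally show ?thesis by (simp add: card_PiE fin)
qed

section \<open>The two sample spaces of shifts and their uniformity on small sets\<close>

definition planted_space :: "nat \<Rightarrow> nat \<Rightarrow> nat \<Rightarrow> (nat set \<times> (nat \<Rightarrow> nat set)) set" where
  "planted_space n m r = Pow {..<n} \<times> PiE {..<m} (\<lambda>_. Pow {..<r})"

definition shift_space :: "nat \<Rightarrow> nat \<Rightarrow> (nat \<Rightarrow> nat set) set" where
  "shift_space m k = PiE {..<m} (\<lambda>_. Pow {..<k})"

lemma finite_spaces [simp]: "finite (planted_space n m r)" "finite (shift_space m k)"
  by (auto simp: planted_space_def shift_space_def intro!: finite_PiE)

lemma spaces_nonempty [simp]: "planted_space n m r \<noteq> {}" "shift_space m k \<noteq> {}"
  by (auto simp: planted_space_def shift_space_def PiE_eq_empty_iff)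

lemma planted_in: "planted k v h \<omega> e \<in> Pow {..<k}"
  by (auto simp: planted_def)

text \<open>The planted word is linear in \<open>\<omega>\<close>, so translation by a preimage of \<open>\<tau> + \<tau>'\<close> maps the
  fibre over \<open>\<tau>\<close> injectively into the fibre over \<open>\<tau>'\<close>.\<close>

lemma card_agree_planted_le:
  assumes k: "k \<ge> 3" and ex: "expanding k m h q" and hn: "\<And>e i. h e i < n"
    and v: "inj_on v {..<k}" "\<And>i. i < k \<Longrightarrow> v i \<subseteq> {..<r}" "\<And>i. i < k \<Longrightarrow> v i \<noteq> {}"
    and Q: "Q \<subseteq> {..<m}" "card Q \<le> q"
    and \<tau>: "\<forall>e\<in>Q. \<tau> e \<in> Pow {..<k}" "\<forall>e\<in>Q. \<tau>' e \<in> Pow {..<k}"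
  shows "card (agree (planted_space n m r) (planted k v h) Q \<tau>)
    \<le> card (agree (planted_space n m r) (planted k v h) Q \<tau>')"
proof -
  have "\<exists>\<sigma> a. \<sigma> \<subseteq> {..<n} \<and> (\<forall>e. a e \<subseteq> {..<r}) \<and>
      (\<forall>e\<in>Q. planted k v h (\<sigma>, a) e = sym_diff (\<tau> e) (\<tau>' e))"
    by (rule planted_surj[OF k ex hn v Q]) (use \<tau> in auto)
  then obtain \<sigma>0 a0 where 0: "\<sigma>0 \<subseteq> {..<n}" "\<And>e. a0 e \<subseteq> {..<r}"
    "\<And>e. e \<in> Q \<Longrightarrow> planted k v h (\<sigma>0, a0) e = sym_diff (\<tau> e) (\<tau>' e)" by blast
  \<comment> \<open>The restriction to \<open>e < m\<close> keeps the translate inside the space of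
    extensional functions.\<close>
  define \<phi> where "\<phi> = (\<lambda>(\<sigma>, a). (sym_diff \<sigma> \<sigma>0, \<lambda>e\<in>{..<m}. sym_diff (a e) (a0 e)))"
  have cancel: "A = B" if "sym_diff A C = sym_diff B C" for A B C :: "nat set"
    using that by blast
  show ?thesis
  proof (rule card_inj_on_le[of \<phi>])
    have "inj_on \<phi> (planted_space n m r)"
    proof (rule inj_onI, clarsimp)
      fix \<sigma> a \<sigma>' a'
      assume *: "(\<sigma>, a) \<in> planted_space n m r" "(\<sigma>', a') \<in> planted_space n m r" "\<phi> (\<sigma>, a) = \<phi> (\<sigma>', a')"
      have 1: "sym_diff \<sigma> \<sigma>0 = sym_diff \<sigma>' \<sigma>0"
        and 2: "(\<lambda>e\<in>{..<m}. sym_diff (a e) (a0 e)) = (\<lambda>e\<in>{..<m}. sym_diff (a' e) (a0 e))"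
        using *(3) by (simp_all add: \<phi>_def)
      have "\<sigma> = \<sigma>'" using 1 by (rule cancel)
      moreover have "a e = a' e" if "e < m" for e
      proof -
        have "sym_diff (a e) (a0 e) = sym_diff (a' e) (a0 e)"
          using fun_cong[OF 2, of e] that by (simp only: restrict_apply lessThan_iff if_True)
        then show ?thesis by (rule cancel)
      qed
      moreover have "a \<in> PiE {..<m} (\<lambda>_. Pow {..<r})" "a' \<in> PiE {..<m} (\<lambda>_. Pow {..<r})"
        using *(1,2) by (simp_all add: planted_space_def)
      ultimately have "\<sigma> = \<sigma>'" "a = a'"
        using PiE_ext[of a "{..<m}" "\<lambda>_. Pow {..<r}" a'] by blast+
      then show "\<sigma> = \<sigma>' \<and> a = a'" by simp
    qed
    then show "inj_on \<phi> (agree (planted_space n m r) (planted k v h) Q \<tau>)"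
      by (rule inj_on_subset) (auto simp: agree_def)
    show "\<phi> ` agree (planted_space n m r) (planted k v h) Q \<tau> \<subseteq> agree (planted_space n m r) (planted k v h) Q \<tau>'"
    proof clarsimp
      fix \<sigma> a assume a: "(\<sigma>, a) \<in> agree (planted_space n m r) (planted k v h) Q \<tau>"
      have "\<phi> (\<sigma>, a) \<in> planted_space n m r"
        using a 0(1,2) by (force simp: agree_def planted_space_def \<phi>_def PiE_iff)
      moreover have "planted k v h (\<phi> (\<sigma>, a)) e = \<tau>' e" if e: "e \<in> Q" for e
      proof -
        have em: "e < m" using e Q by auto
        have "i \<in> planted k v h (\<phi> (\<sigma>, a)) e \<longleftrightarrow> i \<in> \<tau>' e" if i: "i < k" for i
        proof -
          have "finite (v i)" using v(2)[OF i] finite_subset by blast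
          then have par: "even (card (sym_diff (a e) (a0 e) \<inter> v i)) \<longleftrightarrow>
              (even (card (a e \<inter> v i)) \<longleftrightarrow> even (card (a0 e \<inter> v i)))"
            using odd_card_sym_diff[of "v i" "a e" "a0 e"] by blast
          have "i \<in> planted k v h (\<sigma>, a) e \<longleftrightarrow> i \<in> \<tau> e" using a e by (auto simp: agree_def)
          moreover have "i \<in> planted k v h (\<sigma>0, a0) e \<longleftrightarrow> (i \<in> \<tau> e) \<noteq> (i \<in> \<tau>' e)"
            using 0(3)[OF e] by auto
          moreover have "i \<in> planted k v h (\<phi> (\<sigma>, a)) e \<longleftrightarrow>
              (i \<in> planted k v h (\<sigma>, a) e) \<noteq> (i \<in> planted k v h (\<sigma>0, a0) e)"
            using i em by (simp add: planted_def \<phi>_def par del: Int_Un_distrib2 Int_Un_distrib) blast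
          ultimately show ?thesis by blast
        qed
        moreover have "\<tau>' e \<subseteq> {..<k}" using \<tau>(2) e by auto
        moreover have "planted k v h (\<phi> (\<sigma>, a)) e \<subseteq> {..<k}" by (auto simp: planted_def)
        ultimately show ?thesis by blast
      qed
      ultimately show "\<phi> (\<sigma>, a) \<in> agree (planted_space n m r) (planted k v h) Q \<tau>'"
        by (simp add: agree_def)
    qed
  qed (simp add: agree_def)
qed

text \<open>Overwriting the shifts on \<open>Q\<close> by \<open>\<tau>'\<close> is injective on the
  fibre over \<open>\<tau>\<close>, where they were already fixed.\<close>

lemma card_agree_shift_le:
  assumes Q: "Q \<subseteq> {..<m}" and \<tau>: "\<forall>e\<in>Q. \<tau> e \<in> Pow {..<k}" "\<forall>e\<in>Q. \<tau>' e \<in> Pow {..<k}"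
  shows "card (agree (shift_space m k) (\<lambda>s. s) Q \<tau>) \<le> card (agree (shift_space m k) (\<lambda>s. s) Q \<tau>')"
proof (rule card_inj_on_le[of "\<lambda>s e. if e \<in> Q then \<tau>' e else s e"])
  show "inj_on (\<lambda>s e. if e \<in> Q then \<tau>' e else s e) (agree (shift_space m k) (\<lambda>s. s) Q \<tau>)"
  proof (rule inj_onI, rule ext)
    fix s s' e
    assume "s \<in> agree (shift_space m k) (\<lambda>s. s) Q \<tau>" "s' \<in> agree (shift_space m k) (\<lambda>s. s) Q \<tau>"
      and *: "(\<lambda>e. if e \<in> Q then \<tau>' e else s e) = (\<lambda>e. if e \<in> Q then \<tau>' e else s' e)"
    then show "s e = s' e"
      using fun_cong[OF *, of e] by (cases "e \<in> Q") (auto simp: agree_def)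
  qed
  show "(\<lambda>s e. if e \<in> Q then \<tau>' e else s e) ` agree (shift_space m k) (\<lambda>s. s) Q \<tau>
      \<subseteq> agree (shift_space m k) (\<lambda>s. s) Q \<tau>'"
    using Q \<tau> by (fastforce simp: agree_def shift_space_def PiE_iff extensional_def)
qed (simp add: agree_def)

text \<open>In either space every fibre over \<open>Q\<close> holds the fraction
  \<open>1 / card (Pow {..<k}) ^ card Q\<close>; the equality of the two fractions is stated
  cross-multiplied.\<close>

lemma card_agree_planted_shift:
  assumes k: "k \<ge> 3" and ex: "expanding k m h q" and hn: "\<And>e i. h e i < n"
    and v: "inj_on v {..<k}" "\<And>i. i < k \<Longrightarrow> v i \<subseteq> {..<r}" "\<And>i. i < k \<Longrightarrow> v i \<noteq> {}"
    and Q: "Q \<subseteq> {..<m}" "card Q \<le> q" and \<tau>: "\<forall>e\<in>Q. \<tau> e \<in> Pow {..<k}"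
  shows "card (shift_space m k) * card (agree (planted_space n m r) (planted k v h) Q \<tau>)
    = card (planted_space n m r) * card (agree (shift_space m k) (\<lambda>s. s) Q \<tau>)"
proof -
  have fQ: "finite Q" using Q finite_subset by blast
  have "card (planted_space n m r)
      = card (Pow {..<k}) ^ card Q * card (agree (planted_space n m r) (planted k v h) Q \<tau>)"
    using fQ \<tau> by (intro card_agree_uniform card_agree_planted_le[OF k ex hn v Q] planted_in) auto
  moreover have "card (shift_space m k)
      = card (Pow {..<k}) ^ card Q * card (agree (shift_space m k) (\<lambda>s. s) Q \<tau>)"
    using fQ \<tau> Q by (intro card_agree_uniform card_agree_shift_le) (auto simp: shift_space_def PiE_iff intro!: finite_PiE)
  ultimately show ?thesis by simp
qed

section \<open>Running a decision tree on both spaces\<close>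

lemma card_agree_split:
  assumes "finite \<Omega>" "finite U" "\<And>\<omega>. \<omega> \<in> \<Omega> \<Longrightarrow> S \<omega> e \<in> U" "e \<notin> Q"
  shows "card {\<omega> \<in> agree \<Omega> S Q \<tau>. P \<omega>} = (\<Sum>u\<in>U. card {\<omega> \<in> agree \<Omega> S (insert e Q) (\<tau>(e := u)). P \<omega>})"
proof -
  have fin: "finite (agree \<Omega> S Q \<tau>)" using assms(1) by (simp add: agree_def)
  have eq: "{\<omega> \<in> {\<omega> \<in> agree \<Omega> S Q \<tau>. P \<omega>}. S \<omega> e = u} = {\<omega> \<in> agree \<Omega> S (insert e Q) (\<tau>(e := u)). P \<omega>}" for u
    using assms(4) by (auto simp: agree_def)
  have "card {\<omega> \<in> agree \<Omega> S Q \<tau>. P \<omega>} = (\<Sum>\<omega>\<in>{\<omega> \<in> agree \<Omega> S Q \<tau>. P \<omega>}. 1)" by simp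
  also have "\<dots> = (\<Sum>u\<in>U. \<Sum>\<omega>\<in>{\<omega> \<in> {\<omega> \<in> agree \<Omega> S Q \<tau>. P \<omega>}. S \<omega> e = u}. 1)"
    by (rule sum.group[symmetric]) (use assms fin in \<open>auto simp: agree_def\<close>)
  finally show ?thesis by (simp only: eq) simp
qed

text \<open>Induction on the tree, where \<open>Q\<close> is the set of edges revealed so far with
  shifts \<open>\<tau>\<close>. The edge behind a query, given by \<open>g\<close>, does not depend
  on the shifts, so only the revealed shift is random. The invariant is that the remaining queries
  and the revealed edges together number at most \<open>q\<close>; at a leaf it allows the use of
  \<open>match\<close>.\<close>

lemma card_accepts_eq:
  fixes \<Phi> :: "nat \<Rightarrow> 'v \<Rightarrow> cstr" and g :: "nat \<Rightarrow> nat \<Rightarrow> nat option"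
    and S :: "'a \<Rightarrow> nat \<Rightarrow> 'v" and S' :: "'b \<Rightarrow> nat \<Rightarrow> 'v"
  defines "orc \<equiv> \<lambda>s x i. map_option (\<lambda>e. \<Phi> e (s e)) (g x i)"
  assumes fin: "finite \<Omega>" "finite \<Omega>'" "finite U"
    and S: "\<And>\<omega> e. \<omega> \<in> \<Omega> \<Longrightarrow> e < m \<Longrightarrow> S \<omega> e \<in> U" "\<And>\<omega> e. \<omega> \<in> \<Omega>' \<Longrightarrow> e < m \<Longrightarrow> S' \<omega> e \<in> U"
    and g: "\<And>x i e. g x i = Some e \<Longrightarrow> e < m"
    and match: "\<And>Q \<tau>. \<lbrakk>Q \<subseteq> {..<m}; card Q \<le> q; \<forall>e\<in>Q. \<tau> e \<in> U\<rbrakk>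
      \<Longrightarrow> N' * card (agree \<Omega> S Q \<tau>) = N * card (agree \<Omega>' S' Q \<tau>)"
    and "Q \<subseteq> {..<m}" "\<forall>e\<in>Q. \<tau> e \<in> U"
    and "\<And>s. (\<forall>e\<in>Q. s e = \<tau> e) \<Longrightarrow> num_queries T (orc s) + card Q \<le> q"
  shows "N' * card {\<omega> \<in> agree \<Omega> S Q \<tau>. accepts T (orc (S \<omega>))}
    = N * card {\<omega> \<in> agree \<Omega>' S' Q \<tau>. accepts T (orc (S' \<omega>))}"
  using assms(9-)
proof (induction T arbitrary: Q \<tau>)
  case (Answer b)
  then show ?case using match[of Q \<tau>] by (cases b) auto
next
  case (Ask x i f)
  have finQ: "finite Q" using Ask.prems(1) finite_subset by blast
  show ?case
  proof (cases "g x i")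
    case None
    then have o: "orc s x i = None" for s by (simp add: orc_def)
    have "N' * card {\<omega> \<in> agree \<Omega> S Q \<tau>. accepts (f None) (orc (S \<omega>))}
      = N * card {\<omega> \<in> agree \<Omega>' S' Q \<tau>. accepts (f None) (orc (S' \<omega>))}"
    proof (rule Ask.IH)
      fix s assume "\<forall>e\<in>Q. s e = \<tau> e"
      then show "num_queries (f None) (orc s) + card Q \<le> q"
        using Ask.prems(3)[of s] by (simp add: o)
    qed (use Ask.prems in auto)
    then show ?thesis by (simp add: o)
  next
    case (Some e)
    then have em: "e < m" by (rule g)
    have o: "orc s x i = Some (\<Phi> e (s e))" for s by (simp add: orc_def Some)
    show ?thesis
    proof (cases "e \<in> Q")
      \<comment> \<open>The edge is already revealed, so the answer is determined by
        \<open>\<tau>\<close> and the event does not change.\<close>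
      case True
      have "N' * card {\<omega> \<in> agree \<Omega> S Q \<tau>. accepts (f (Some (\<Phi> e (\<tau> e)))) (orc (S \<omega>))}
        = N * card {\<omega> \<in> agree \<Omega>' S' Q \<tau>. accepts (f (Some (\<Phi> e (\<tau> e)))) (orc (S' \<omega>))}"
      proof (rule Ask.IH)
        fix s assume "\<forall>e\<in>Q. s e = \<tau> e"
        then show "num_queries (f (Some (\<Phi> e (\<tau> e)))) (orc s) + card Q \<le> q"
          using Ask.prems(3)[of s] True by (simp add: o)
      qed (use Ask.prems in auto)
      moreover have "{\<omega> \<in> agree \<Omega> S Q \<tau>. accepts (Ask x i f) (orc (S \<omega>))}
          = {\<omega> \<in> agree \<Omega> S Q \<tau>. accepts (f (Some (\<Phi> e (\<tau> e)))) (orc (S \<omega>))}"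
        "{\<omega> \<in> agree \<Omega>' S' Q \<tau>. accepts (Ask x i f) (orc (S' \<omega>))}
          = {\<omega> \<in> agree \<Omega>' S' Q \<tau>. accepts (f (Some (\<Phi> e (\<tau> e)))) (orc (S' \<omega>))}"
        using True by (auto simp: agree_def o)
      ultimately show ?thesis by simp
    next
      case False
      \<comment> \<open>A new edge: condition on its shift \<open>u\<close>. One query is traded for
        one revealed edge, so the budget is kept.\<close>
      have IH: "N' * card {\<omega> \<in> agree \<Omega> S (insert e Q) (\<tau>(e := u)). accepts (f (Some (\<Phi> e u))) (orc (S \<omega>))}
        = N * card {\<omega> \<in> agree \<Omega>' S' (insert e Q) (\<tau>(e := u)). accepts (f (Some (\<Phi> e u))) (orc (S' \<omega>))}"
        if "u \<in> U" for u
      proof (rule Ask.IH)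
        fix s assume s: "\<forall>e'\<in>insert e Q. s e' = (\<tau>(e := u)) e'"
        then have "\<forall>e'\<in>Q. s e' = \<tau> e'" using False by auto
        then show "num_queries (f (Some (\<Phi> e u))) (orc s) + card (insert e Q) \<le> q"
          using Ask.prems(3)[of s] s False finQ by (simp add: o)
      qed (use Ask.prems False em that in auto)
      have 1: "{\<omega> \<in> agree \<Omega> S (insert e Q) (\<tau>(e := u)). accepts (Ask x i f) (orc (S \<omega>))}
          = {\<omega> \<in> agree \<Omega> S (insert e Q) (\<tau>(e := u)). accepts (f (Some (\<Phi> e u))) (orc (S \<omega>))}"
        "{\<omega> \<in> agree \<Omega>' S' (insert e Q) (\<tau>(e := u)). accepts (Ask x i f) (orc (S' \<omega>))}
          = {\<omega> \<in> agree \<Omega>' S' (insert e Q) (\<tau>(e := u)). accepts (f (Some (\<Phi> e u))) (orc (S' \<omega>))}" for u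
        by (auto simp: agree_def o)
      have "card {\<omega> \<in> agree \<Omega> S Q \<tau>. accepts (Ask x i f) (orc (S \<omega>))}
          = (\<Sum>u\<in>U. card {\<omega> \<in> agree \<Omega> S (insert e Q) (\<tau>(e := u)). accepts (Ask x i f) (orc (S \<omega>))})"
        by (rule card_agree_split) (use fin S em False in auto)
      moreover have "card {\<omega> \<in> agree \<Omega>' S' Q \<tau>. accepts (Ask x i f) (orc (S' \<omega>))}
          = (\<Sum>u\<in>U. card {\<omega> \<in> agree \<Omega>' S' (insert e Q) (\<tau>(e := u)). accepts (Ask x i f) (orc (S' \<omega>))})"
        by (rule card_agree_split) (use fin S em False in auto)
      ultimately show ?thesis
        unfolding 1 by (simp add: sum_distrib_left IH del: accepts.simps)
    qed
  qed
qed

text \<open>Passes from trees to randomized algorithms: summed over a finite space, the acceptance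
  probabilities give the expected number of accepted elements, and the hypothesis compares these
  numbers for every tree in the support.\<close>

lemma sum_prob_eq_of_card_eq:
  fixes A :: "'t pmf"
  assumes fin: "finite \<Omega>" "finite \<Omega>'"
    and eq: "\<And>t. t \<in> set_pmf A \<Longrightarrow> N' * card {\<omega> \<in> \<Omega>. P t \<omega>} = N * card {\<omega> \<in> \<Omega>'. P' t \<omega>}"
  shows "real N' * (\<Sum>\<omega>\<in>\<Omega>. measure_pmf.prob A {t. P t \<omega>})
    = real N * (\<Sum>\<omega>\<in>\<Omega>'. measure_pmf.prob A {t. P' t \<omega>})"
proof -
  have *: "(\<Sum>\<omega>\<in>X. measure_pmf.prob A {t. R t \<omega>}) = measure_pmf.expectation A (\<lambda>t. real (card {\<omega> \<in> X. R t \<omega>}))"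
    if "finite X" for X :: "'c set" and R
  proof -
    have "(\<Sum>\<omega>\<in>X. measure_pmf.prob A {t. R t \<omega>})
        = (\<Sum>\<omega>\<in>X. measure_pmf.expectation A (indicator {t. R t \<omega>}))"
      by simp
    also have "\<dots> = measure_pmf.expectation A (\<lambda>t. \<Sum>\<omega>\<in>X. indicator {t. R t \<omega>} t)"
      by (rule Bochner_Integration.integral_sum[symmetric])
        (auto intro!: measure_pmf.integrable_const_bound[where B = 1])
    also have "(\<lambda>t. \<Sum>\<omega>\<in>X. indicator {t. R t \<omega>} t :: real) = (\<lambda>t. real (card {\<omega> \<in> X. R t \<omega>}))"
      using that by (auto simp: indicator_def sum.If_cases Int_def)
    finally show ?thesis .
  qed
  have "measure_pmf.expectation A (\<lambda>t. real N' * real (card {\<omega> \<in> \<Omega>. P t \<omega>}))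
      = measure_pmf.expectation A (\<lambda>t. real N * real (card {\<omega> \<in> \<Omega>'. P' t \<omega>}))"
    by (intro integral_cong_AE) (auto simp: AE_measure_pmf_iff eq simp flip: of_nat_mult)
  then show ?thesis by (simp add: *[OF fin(1)] *[OF fin(2)])
qed

section \<open>Distance from satisfiability\<close>

text \<open>Exponential moment of the number of satisfied edges when \<open>W e\<close> is the word
  that a fixed assignment induces on edge \<open>e\<close>. The shifts are independent, so it
  factors over the edges, and each edge is satisfied by at most \<open>2 * k\<close> of its
  \<open>2 ^ k\<close> shifts.\<close>

lemma sum_exp_card_le:
  fixes \<theta> :: real
  assumes \<theta>: "\<theta> \<ge> 0" and V: "finite V" "card V \<le> 2 * k"
  shows "(\<Sum>s\<in>shift_space m k. exp (\<theta> * real (card {e. e < m \<and> sym_diff (W e) (s e) \<in> V})))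
    \<le> (2 ^ k) ^ m * exp (real m * (2 * real k / 2 ^ k * (exp \<theta> - 1)))"
proof -
  define c where "c e u = (if sym_diff (W e) u \<in> V then exp \<theta> else 1)" for e :: nat and u
  have "exp (\<theta> * real (card {e. e < m \<and> sym_diff (W e) (s e) \<in> V})) = (\<Prod>e<m. c e (s e))" for s
  proof -
    have "{e. e < m \<and> sym_diff (W e) (s e) \<in> V} = {e \<in> {..<m}. sym_diff (W e) (s e) \<in> V}" by auto
    then have "real (card {e. e < m \<and> sym_diff (W e) (s e) \<in> V})
        = (\<Sum>e<m. if sym_diff (W e) (s e) \<in> V then 1 else 0)"
      by (simp flip: sum.inter_filter)
    then have "exp (\<theta> * real (card {e. e < m \<and> sym_diff (W e) (s e) \<in> V}))
        = exp (\<Sum>e<m. \<theta> * (if sym_diff (W e) (s e) \<in> V then 1 else 0))"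
      by (simp add: sum_distrib_left)
    also have "\<dots> = (\<Prod>e<m. c e (s e))"
      unfolding exp_sum[OF finite_lessThan] c_def by (intro prod.cong) auto
    finally show ?thesis .
  qed
  then have "(\<Sum>s\<in>shift_space m k. exp (\<theta> * real (card {e. e < m \<and> sym_diff (W e) (s e) \<in> V})))
      = (\<Sum>s\<in>shift_space m k. \<Prod>e<m. c e (s e))"
    by simp
  also have "\<dots> = (\<Prod>e<m. \<Sum>u\<in>Pow {..<k}. c e u)"
    unfolding shift_space_def by (rule prod_sum_PiE[symmetric]) auto
  also have "\<dots> \<le> (\<Prod>e<m. 2 ^ k * exp (2 * real k / 2 ^ k * (exp \<theta> - 1)))"
  proof (intro prod_mono conjI)
    fix e
    show "0 \<le> (\<Sum>u\<in>Pow {..<k}. c e u)" by (intro sum_nonneg) (auto simp: c_def)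
    have "card {u \<in> Pow {..<k}. sym_diff (W e) u \<in> V} \<le> card V"
    proof (rule card_inj_on_le)
      show "inj_on (sym_diff (W e)) {u \<in> Pow {..<k}. sym_diff (W e) u \<in> V}"
      proof (rule inj_onI)
        fix u u' assume "sym_diff (W e) u = sym_diff (W e) u'"
        then show "u = u'" by blast
      qed
    qed (use V in auto)
    then have le: "real (card {u \<in> Pow {..<k}. sym_diff (W e) u \<in> V}) \<le> 2 * real k"
      using V(2) by linarith
    have "(\<Sum>u\<in>Pow {..<k}. c e u)
        = (\<Sum>u\<in>Pow {..<k}. 1 + (if sym_diff (W e) u \<in> V then exp \<theta> - 1 else 0))"
      by (intro sum.cong) (auto simp: c_def)
    also have "\<dots> = 2 ^ k + real (card {u \<in> Pow {..<k}. sym_diff (W e) u \<in> V}) * (exp \<theta> - 1)"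
      by (simp add: sum.distrib card_Pow flip: sum.inter_filter)
    also have "\<dots> \<le> 2 ^ k + 2 * real k * (exp \<theta> - 1)"
      using le \<theta> by (intro add_left_mono mult_right_mono) auto
    also have "\<dots> = 2 ^ k * (1 + 2 * real k / 2 ^ k * (exp \<theta> - 1))"
      by (simp add: field_simps)
    also have "\<dots> \<le> 2 ^ k * exp (2 * real k / 2 ^ k * (exp \<theta> - 1))"
      by (intro mult_left_mono exp_ge_add_one_self) auto
    finally show "(\<Sum>u\<in>Pow {..<k}. c e u) \<le> 2 ^ k * exp (2 * real k / 2 ^ k * (exp \<theta> - 1))" .
  qed
  also have "\<dots> = (2 ^ k) ^ m * exp (real m * (2 * real k / 2 ^ k * (exp \<theta> - 1)))"
    by (simp only: prod_constant card_lessThan power_mult_distrib exp_of_nat_mult)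
  finally show ?thesis .
qed

text \<open>Markov's inequality applied to the exponential moment.\<close>

lemma card_many_satisfied_le:
  fixes \<theta> y :: real
  assumes \<theta>: "\<theta> \<ge> 0" and V: "finite V" "card V \<le> 2 * k"
  shows "real (card {s \<in> shift_space m k. y \<le> real (card {e. e < m \<and> sym_diff (W e) (s e) \<in> V})})
    \<le> (2 ^ k) ^ m * exp (real m * (2 * real k / 2 ^ k * (exp \<theta> - 1)) - \<theta> * y)"
    (is "real (card ?B) \<le> _")
proof -
  let ?c = "\<lambda>s. real (card {e. e < m \<and> sym_diff (W e) (s e) \<in> V})"
  have "real (card ?B) * exp (\<theta> * y) = (\<Sum>s\<in>?B. exp (\<theta> * y))" by simp
  also have "\<dots> \<le> (\<Sum>s\<in>?B. exp (\<theta> * ?c s))"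
    using \<theta> by (intro sum_mono) (auto intro: mult_left_mono)
  also have "\<dots> \<le> (\<Sum>s\<in>shift_space m k. exp (\<theta> * ?c s))"
    by (intro sum_mono2) auto
  also have "\<dots> \<le> (2 ^ k) ^ m * exp (real m * (2 * real k / 2 ^ k * (exp \<theta> - 1)))"
    using \<theta> V by (rule sum_exp_card_le)
  finally show ?thesis
    by (simp only: exp_diff times_divide_eq_right pos_le_divide_eq[OF exp_gt_zero])
qed

text \<open>Writes \<open>2 ^ k\<close> as \<open>(3 / 2) ^ k * (4 / 3) ^ k\<close>: the second
  factor absorbs the exponential, the first one, with the constant 5, absorbs the square.\<close>

lemma square_mult_exp_le:
  assumes "k \<ge> 3"
  shows "(real k)\<^sup>2 * exp (real k / 20) \<le> 5 * 2 ^ k"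
proof -
  have exp_le: "exp (1 / 20 :: real) \<le> 4 / 3"
    using exp_bound_lemma[of "1 / 20 :: real"] by simp
  have "exp (real k / 20) = exp (1 / 20) ^ k" by (simp flip: exp_of_nat_mult)
  also have "\<dots> \<le> (4 / 3) ^ k" using exp_le by (intro power_mono) auto
  finally have "(real k)\<^sup>2 * exp (real k / 20) \<le> (real k)\<^sup>2 * (4 / 3) ^ k"
    by (intro mult_left_mono) auto
  also have "(real k)\<^sup>2 * (4 / 3) ^ k \<le> 5 * (3 / 2) ^ k * (4 / 3) ^ k"
  proof (intro mult_right_mono)
    show "(real k)\<^sup>2 \<le> 5 * (3 / 2) ^ k"
    \<comment> \<open>The induction starts at 5 because
      \<open>((j + 1) / j)\<^sup>2 \<le> 3 / 2\<close> fails for \<open>j = 4\<close>.\<close>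
    proof (cases "k < 5")
      case True
      with assms have "k = 3 \<or> k = 4" by auto
      then show ?thesis by (auto simp: power2_eq_square eval_nat_numeral)
    next
      case False
      then have "5 \<le> k" by simp
      then show ?thesis
      proof (induction k rule: dec_induct)
        case base
        then show ?case by (simp add: eval_nat_numeral)
      next
        case (step j)
        have "2 * (real j + 1)\<^sup>2 \<le> 3 * (real j)\<^sup>2"
        proof -
          have "5 * real j \<le> real j * real j" using step by (intro mult_right_mono) auto
          moreover have "5 \<le> real j" using step by simp
          moreover have "2 * (real j + 1)\<^sup>2 = 2 * (real j * real j) + 4 * real j + 2"
            by (simp add: power2_eq_square algebra_simps)
          ultimately show ?thesis unfolding power2_eq_square[of "real j"] by linarith
        qed
        with step show ?case by (simp add: add.commute)
      qed
    qed
  qed auto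
  also have "\<dots> = 5 * 2 ^ k" by (simp flip: power_mult_distrib)
  finally show ?thesis .
qed

text \<open>Follows from \<open>exp \<theta> - 1 - \<theta> \<le> \<theta>\<^sup>2 * exp
  \<theta>\<close>. A value of \<open>\<theta>\<close> proportional to \<open>k\<close> is
  affordable because the success probability \<open>2 * k / 2 ^ k\<close> is small; it will cancel
  the \<open>1 / k\<close> in the number of edges and so keep \<open>d\<close> independent of
  \<open>k\<close>.\<close>

lemma chernoff_exponent:
  fixes \<epsilon> :: real
  assumes k: "k \<ge> 3" and \<epsilon>: "0 < \<epsilon>" "\<epsilon> \<le> 1"
  defines "\<theta> \<equiv> real k * \<epsilon> / 20"
  shows "2 * real k / 2 ^ k * (exp \<theta> - 1 - \<theta>) \<le> \<theta> * \<epsilon> / 2"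
proof -
  have \<theta>: "0 \<le> \<theta>" using \<epsilon> by (simp add: \<theta>_def)
  have "(1 + - \<theta>) * exp \<theta> \<le> exp (- \<theta>) * exp \<theta>"
    by (intro mult_right_mono exp_ge_add_one_self) auto
  then have "exp \<theta> - 1 \<le> \<theta> * exp \<theta>"
    by (simp add: algebra_simps flip: exp_add)
  then have "exp \<theta> - 1 - \<theta> \<le> \<theta> * (exp \<theta> - 1)" by (simp add: algebra_simps)
  also have "\<dots> \<le> \<theta> * (\<theta> * exp \<theta>)"
    using \<open>exp \<theta> - 1 \<le> \<theta> * exp \<theta>\<close> \<theta> by (rule mult_left_mono)
  also have "\<dots> \<le> \<theta> * (\<theta> * exp (real k / 20))"
    using \<theta> \<epsilon> by (intro mult_left_mono) (auto simp: \<theta>_def mult_left_le)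
  finally have "2 * real k / 2 ^ k * (exp \<theta> - 1 - \<theta>)
      \<le> 2 * real k / 2 ^ k * (\<theta> * (\<theta> * exp (real k / 20)))"
    by (intro mult_left_mono) auto
  also have "\<dots> = \<theta> * \<epsilon> * ((real k)\<^sup>2 * exp (real k / 20)) / (10 * 2 ^ k)"
    by (simp add: \<theta>_def power2_eq_square)
  also have "\<dots> \<le> \<theta> * \<epsilon> * (5 * 2 ^ k) / (10 * 2 ^ k)"
    using square_mult_exp_le[OF k] \<theta> \<epsilon> by (intro divide_right_mono mult_left_mono) auto
  finally show ?thesis by (simp add: mult.commute)
qed

section \<open>Constraint satisfaction instances built from shifts\<close>

definition shift_cstr :: "nat \<Rightarrow> nat set set \<Rightarrow> (nat \<Rightarrow> nat \<Rightarrow> nat) \<Rightarrow> nat \<Rightarrow> nat set \<Rightarrow> cstr" where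
  "shift_cstr k V h e u =
     Cstr (map (h e) [0..<k]) (\<lambda>ys. length ys = k \<and> sym_diff {i. i < k \<and> ys ! i} u \<in> V)"

definition shift_csp :: "nat \<Rightarrow> nat set set \<Rightarrow> (nat \<Rightarrow> nat \<Rightarrow> nat) \<Rightarrow> nat \<Rightarrow> (nat \<Rightarrow> nat set) \<Rightarrow> csp" where
  "shift_csp k V h m s = \<lparr>
     cstrs = (\<lambda>e. shift_cstr k V h e (s e)) ` {..<m},
     incident = (\<lambda>x. map (\<lambda>e. shift_cstr k V h e (s e)) (filter (\<lambda>e. x \<in> h e ` {..<k}) [0..<m]))\<rparr>"

lemma pred_shift_cstr:
  "pred (shift_cstr k V h e u) (map \<sigma> (scope (shift_cstr k V h e u)))
    \<longleftrightarrow> sym_diff {i. i < k \<and> \<sigma> (h e i)} u \<in> V"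
proof -
  have "{i. i < k \<and> map \<sigma> (map (h e) [0..<k]) ! i} = {i. i < k \<and> \<sigma> (h e i)}" by auto
  then show ?thesis by (simp add: shift_cstr_def cong: conj_cong)
qed

lemma set_scope_shift_cstr: "set (scope (shift_cstr k V h e u)) = h e ` {..<k}"
  by (auto simp: shift_cstr_def)

text \<open>Two edges on the same vertices would cover at most \<open>k\<close> vertices, but
  expansion demands more than \<open>2 * k - 3\<close>. This keeps different edges from collapsing
  into one constraint, as an instance is a set.\<close>

lemma expanding_scopes_distinct:
  assumes "k \<ge> 3" "expanding k m h q" "q \<ge> 2" "e < m" "e' < m" "h e ` {..<k} = h e' ` {..<k}"
  shows "e = e'"
proof (rule ccontr)
  assume ne: "e \<noteq> e'"
  have "(2 * k - 3) * card {e, e'} < 2 * card (\<Union>e\<in>{e, e'}. h e ` {..<k})"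
    using assms ne by (intro assms(2)[unfolded expanding_def, rule_format]) auto
  also have "(\<Union>e\<in>{e, e'}. h e ` {..<k}) = h e ` {..<k}" using assms(6) by auto
  also have "2 * card \<dots> \<le> 2 * k" using card_image_le[of "{..<k}" "h e"] by simp
  finally show False using ne assms(1) by simp
qed

lemma inj_on_shift_cstr:
  assumes "k \<ge> 3" "expanding k m h q" "q \<ge> 2"
  shows "inj_on (\<lambda>e. shift_cstr k V h e (s e)) {..<m}"
proof (rule inj_onI)
  fix e e' assume *: "e \<in> {..<m}" "e' \<in> {..<m}" "shift_cstr k V h e (s e) = shift_cstr k V h e' (s e')"
  have "h e ` {..<k} = h e' ` {..<k}"
    using arg_cong[OF *(3), of "\<lambda>c. set (scope c)"] by (simp add: set_scope_shift_cstr)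
  with * show "e = e'" by (intro expanding_scopes_distinct[OF assms]) auto
qed

lemma shift_csp_instance:
  assumes "k \<ge> 3" "expanding k m h q" "q \<ge> 2" and hn: "\<And>e i. h e i < n"
    and deg: "\<And>x. card {e. e < m \<and> x \<in> h e ` {..<k}} \<le> d"
  shows "shift_csp k V h m s \<in> csp_instances k d n"
proof -
  have "kary_cstr k n (shift_cstr k V h e (s e))" for e
    using hn by (auto simp: kary_cstr_def shift_cstr_def)
  moreover have "distinct (incident (shift_csp k V h m s) x)" for x
    using inj_on_subset[OF inj_on_shift_cstr[OF assms(1-3)], of "{e. e < m \<and> x \<in> h e ` {..<k}}"]
    by (simp add: shift_csp_def distinct_map lessThan_def Collect_mono conj_commute)
  moreover have "length (incident (shift_csp k V h m s) x) \<le> d" for x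
  proof -
    have "length (incident (shift_csp k V h m s) x) = card (set (filter (\<lambda>e. x \<in> h e ` {..<k}) [0..<m]))"
      by (simp add: shift_csp_def distinct_card del: set_filter)
    also have "set (filter (\<lambda>e. x \<in> h e ` {..<k}) [0..<m]) = {e. e < m \<and> x \<in> h e ` {..<k}}" by auto
    finally show ?thesis using deg by simp
  qed
  ultimately show ?thesis
    by (auto simp: csp_instances_def shift_csp_def set_scope_shift_cstr)
qed

text \<open>Separates the edge returned, which is independent of the shifts, from the constraint on
  it; \<open>card_accepts_eq\<close> needs this form.\<close>

lemma csp_oracle_shift_csp:
  defines "L \<equiv> \<lambda>h k m x. filter (\<lambda>e. x \<in> h e ` {..<k}) [0..<m :: nat]"
  shows "csp_oracle n (shift_csp k V h m s) x i
    = map_option (\<lambda>e. shift_cstr k V h e (s e))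
        (if x < n \<and> 1 \<le> i \<and> i \<le> length (L h k m x) then Some (L h k m x ! (i - 1)) else None)"
  by (auto simp: csp_oracle_def shift_csp_def L_def)

lemma satisfiable_shift_csp:
  assumes "\<And>e. e < m \<Longrightarrow> sym_diff {i. i < k \<and> h e i \<in> \<sigma>} (s e) \<in> V"
  shows "satisfiable (cstrs (shift_csp k V h m s))"
  unfolding satisfiable_def
  by (rule exI[of _ "\<lambda>x. x \<in> \<sigma>"]) (use assms in \<open>auto simp: shift_csp_def pred_shift_cstr\<close>)

text \<open>An assignment satisfying everything outside \<open>R\<close> satisfies at least
  \<open>m - card R\<close> edges, which \<open>few\<close> bounds from above. Only its values below
  \<open>n\<close> matter.\<close>

lemma far_from_sat_shift_csp:
  assumes inj: "inj_on (\<lambda>e. shift_cstr k V h e (s e)) {..<m}" and hn: "\<And>e i. h e i < n"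
    and few: "\<And>\<sigma>. \<sigma> \<subseteq> {..<n} \<Longrightarrow>
      real (card {e. e < m \<and> sym_diff {i. i < k \<and> h e i \<in> \<sigma>} (s e) \<in> V}) \<le> real m - \<delta> * real d * real n / real k"
  shows "far_from_sat \<delta> k d n (shift_csp k V h m s)"
  unfolding far_from_sat_def
proof (intro allI impI)
  fix R assume R: "R \<subseteq> cstrs (shift_csp k V h m s)" "satisfiable (cstrs (shift_csp k V h m s) - R)"
  let ?C = "\<lambda>e. shift_cstr k V h e (s e)"
  have cs: "cstrs (shift_csp k V h m s) = ?C ` {..<m}" by (simp add: shift_csp_def)
  obtain \<sigma> where \<sigma>: "\<And>c. c \<in> ?C ` {..<m} - R \<Longrightarrow> pred c (map \<sigma> (scope c))"
    using R(2) by (auto simp: satisfiable_def cs)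
  have "real m - real (card R) = real (card (?C ` {..<m} - R))"
  proof -
    have "finite R" "card R \<le> m"
      using R(1) finite_subset card_mono[of "?C ` {..<m}" R] card_image[OF inj] by (auto simp: cs)
    then show ?thesis
      using R(1) card_image[OF inj] by (simp add: cs card_Diff_subset of_nat_diff)
  qed
  also have "\<dots> \<le> real (card (?C ` {e. e < m \<and> sym_diff {i. i < k \<and> \<sigma> (h e i)} (s e) \<in> V}))"
  proof (intro of_nat_mono card_mono subsetI)
    fix c assume c: "c \<in> ?C ` {..<m} - R"
    then obtain e where e: "e < m" "c = ?C e" by auto
    with \<sigma>[OF c] have "sym_diff {i. i < k \<and> \<sigma> (h e i)} (s e) \<in> V" by (simp only: pred_shift_cstr)
    with e show "c \<in> ?C ` {e. e < m \<and> sym_diff {i. i < k \<and> \<sigma> (h e i)} (s e) \<in> V}" by simp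
  qed simp
  also have "\<dots> \<le> real (card {e. e < m \<and> sym_diff {i. i < k \<and> \<sigma> (h e i)} (s e) \<in> V})"
    by (intro of_nat_mono card_image_le) auto
  also have "\<dots> = real (card {e. e < m \<and> sym_diff {i. i < k \<and> h e i \<in> {x. x < n \<and> \<sigma> x}} (s e) \<in> V})"
    using hn by simp
  also have "\<dots> \<le> real m - \<delta> * real d * real n / real k"
    by (intro few) auto
  finally show "\<delta> * real d * real n / real k \<le> real (card R)" by linarith
qed

section \<open>The lower bound\<close>

text \<open>For the least \<open>r\<close> with \<open>k < 2 ^ r\<close>, minimality gives
  \<open>2 ^ r \<le> 2 * k\<close>, and there are at least \<open>k\<close> nonzero vectors of
  length \<open>r\<close>.\<close>

lemma ex_code:
  assumes "k \<ge> 3"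
  shows "\<exists>r v. (2::nat) ^ r \<le> 2 * k \<and> inj_on v {..<k} \<and> (\<forall>i<k. v i \<subseteq> {..<r} \<and> v i \<noteq> {})"
proof -
  define r where "r = (LEAST r. k < (2::nat) ^ r)"
  have r: "k < 2 ^ r" unfolding r_def by (rule LeastI[of _ k]) simp
  then have "r \<noteq> 0" using assms by (intro notI) simp
  then obtain r' where r': "r = Suc r'" by (cases r) auto
  have "\<not> k < 2 ^ r'" using not_less_Least[of r' "\<lambda>r. k < (2::nat) ^ r"] r' by (simp add: r_def)
  then have "2 ^ r \<le> 2 * k" by (simp add: r')
  moreover have "card {..<k} \<le> card (Pow {..<r} - {{}})"
    using r by (simp add: card_Pow)
  then obtain v where "v ` {..<k} \<subseteq> Pow {..<r} - {{}}" "inj_on v {..<k}"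
    using card_le_inj[of "{..<k}" "Pow {..<r} - {{}}"] by auto
  ultimately show ?thesis by (intro exI[of _ r] exI[of _ v]) auto
qed

text \<open>The deviation bound gains about \<open>m * \<theta> * \<epsilon> / 2\<close>, which is
  \<open>n * d * \<epsilon>\<^sup>2 / 40\<close> up to rounding and hence at least \<open>n\<close>
  by the choice of \<open>d\<close>. This beats the \<open>2 ^ n\<close> assignments since
  \<open>ln 2 < 1\<close>, and for large \<open>n\<close> it also pays for the lower-order
  terms.\<close>

lemma union_bound_exponent:
  fixes \<epsilon> :: real and k d n m :: nat
  assumes k: "k \<ge> 3" and \<epsilon>: "0 < \<epsilon>" "\<epsilon> \<le> 1" and d: "40 / \<epsilon>\<^sup>2 \<le> real d"
    and m: "real n * real d / real k \<le> real m + 1"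
  defines "\<theta> \<equiv> real k * \<epsilon> / 20" and "p \<equiv> 2 * real k / 2 ^ k"
  assumes n: "ln 2 + \<theta> + \<theta> * \<epsilon> / 2 < real n * (1 - ln 2)"
  shows "2 * 2 ^ n * exp (real m * (p * (exp \<theta> - 1)) - \<theta> * (real m * (p + \<epsilon>) - 1)) < 1"
proof -
  have \<theta>: "0 \<le> \<theta>" using \<epsilon> by (simp add: \<theta>_def)
  have "real m * (p * (exp \<theta> - 1)) - \<theta> * (real m * (p + \<epsilon>) - 1)
      = real m * (p * (exp \<theta> - 1 - \<theta>)) - real m * (\<theta> * \<epsilon>) + \<theta>"
    by (simp add: algebra_simps)
  also have "\<dots> \<le> real m * (\<theta> * \<epsilon> / 2) - real m * (\<theta> * \<epsilon>) + \<theta>"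
    using chernoff_exponent[OF k \<epsilon>] unfolding \<theta>_def p_def
    by (intro add_right_mono diff_right_mono mult_left_mono) auto
  also have "\<dots> = \<theta> + \<theta> * \<epsilon> / 2 - (real m + 1) * (\<theta> * \<epsilon> / 2)"
    by (simp add: field_simps)
  also have "\<dots> \<le> \<theta> + \<theta> * \<epsilon> / 2 - (real n * real d / real k) * (\<theta> * \<epsilon> / 2)"
    using m \<theta> \<epsilon> by (intro diff_left_mono mult_right_mono) auto
  also have "(real n * real d / real k) * (\<theta> * \<epsilon> / 2) = real n * (real d * \<epsilon>\<^sup>2 / 40)"
    using k by (simp add: \<theta>_def power2_eq_square)
  also have "\<theta> + \<theta> * \<epsilon> / 2 - \<dots> \<le> \<theta> + \<theta> * \<epsilon> / 2 - real n * 1"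
    using d \<epsilon> by (intro diff_left_mono mult_left_mono) (auto simp: field_simps)
  also have "\<dots> < - ((real n + 1) * ln 2)" using n by (simp add: algebra_simps)
  finally have "exp (real m * (p * (exp \<theta> - 1)) - \<theta> * (real m * (p + \<epsilon>) - 1))
      < exp (- ((real n + 1) * ln 2))" by simp
  also have "\<dots> = 1 / (2 * 2 ^ n)"
    by (simp only: exp_minus exp_add distrib_right exp_of_nat_mult mult_1 exp_ln zero_less_numeral)
      (simp add: field_simps)
  finally show ?thesis by (simp add: field_simps)
qed

text \<open>With at most \<open>q0\<close> queries the average acceptance probabilities over planted
  and over uniform shifts coincide. The former is at least \<open>2 / 3\<close>; the latter is
  smaller, since more than half of the uniform shifts are far from satisfiable and accepted with
  probability at most \<open>1 / 3\<close>.\<close>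

lemma tester_queries_gt:
  fixes \<epsilon> :: real and k d n q q0 :: nat
  assumes k: "k \<ge> 3" and \<epsilon>: "0 < \<epsilon>" and \<delta>: "0 < 1 - 2 * real k / 2 ^ k - \<epsilon>"
    and d: "40 / \<epsilon>\<^sup>2 \<le> real d" and n: "n > 0"
    and large: "ln 2 + real k * \<epsilon> / 20 + real k * \<epsilon> / 20 * \<epsilon> / 2 < real n * (1 - ln 2)"
    and q0: "4 * exp (2 * real k + 2) * (real d)\<^sup>2 * real k ^ 3 * real q0 \<le> real n" "q0 \<ge> 2"
    and tester: "is_tester (1 - 2 * real k / 2 ^ k - \<epsilon>) k d n A"
    and queries: "makes_at_most k d n A q"
  shows "q0 < q"
proof (rule ccontr)
  assume "\<not> q0 < q"
  then have qq: "q \<le> q0" by simp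
  define \<delta> where "\<delta> = 1 - 2 * real k / 2 ^ k - \<epsilon>"
  define p where "p = 2 * real k / 2 ^ k"
  define m where "m = n * d div k"
  have p0: "0 \<le> p" by (simp add: p_def)
  have \<epsilon>1: "\<epsilon> \<le> 1" using \<delta> p0 unfolding p_def by linarith
  have "0 < 40 / \<epsilon>\<^sup>2" using \<epsilon> by simp
  then have d0: "d > 0" using d by (intro gr0I) auto
  obtain h where hn: "\<And>e i. h e i < n"
    and deg: "\<And>x. card {e. e < m \<and> x \<in> h e ` {..<k}} \<le> d" and ex: "expanding k m h q0"
    using ex_expanding[OF k d0 n q0(1)] unfolding m_def by blast
  obtain r v where r: "(2::nat) ^ r \<le> 2 * k" and v: "inj_on v {..<k}"
    "\<And>i. i < k \<Longrightarrow> v i \<subseteq> {..<r}" "\<And>i. i < k \<Longrightarrow> v i \<noteq> {}"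
    using ex_code[OF k] by blast
  \<comment> \<open>The linear code: position \<open>i\<close> of the word of \<open>a\<close> is
    the inner product of \<open>a\<close> and \<open>v i\<close>.\<close>
  define V where "V = (\<lambda>a. {i. i < k \<and> odd (card (a \<inter> v i))}) ` Pow {..<r}"
  have V: "finite V" "card V \<le> 2 * k"
  proof -
    have "card V \<le> card (Pow {..<r})" unfolding V_def by (intro card_image_le) auto
    with r show "card V \<le> 2 * k" by (simp add: card_Pow)
  qed (simp add: V_def)
  define I where "I = shift_csp k V h m"
  define \<Phi> where "\<Phi> = shift_cstr k V h"
  define L where "L x = filter (\<lambda>e. x \<in> h e ` {..<k}) [0..<m]" for x
  define g where "g x i = (if x < n \<and> 1 \<le> i \<and> i \<le> length (L x) then Some (L x ! (i - 1)) else None)" for x i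
  have orc: "csp_oracle n (I s) = (\<lambda>x i. map_option (\<lambda>e. \<Phi> e (s e)) (g x i))" for s
    unfolding I_def \<Phi>_def g_def L_def by (intro ext csp_oracle_shift_csp)
  have gm: "e < m" if "g x i = Some e" for x i e
  proof -
    have "e = L x ! (i - 1)" "i - 1 < length (L x)" using that by (auto simp: g_def split: if_splits)
    then have "e \<in> set (L x)" using nth_mem by blast
    then show ?thesis by (simp add: L_def)
  qed
  have inst: "I s \<in> csp_instances k d n" for s
    unfolding I_def by (rule shift_csp_instance[OF k ex q0(2) hn deg])
  let ?\<Omega> = "planted_space n m r" and ?\<Omega>' = "shift_space m k"
  let ?S = "planted k v h"
  have eq: "card ?\<Omega>' * card {\<omega> \<in> ?\<Omega>. accepts t (csp_oracle n (I (?S \<omega>)))}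
      = card ?\<Omega> * card {s \<in> ?\<Omega>'. accepts t (csp_oracle n (I s))}" if t: "t \<in> set_pmf A" for t
  proof -
    \<comment> \<open>Nothing is revealed at the root: \<open>Q\<close> is empty,
      \<open>\<tau>\<close> is arbitrary and \<open>agree\<close> is the whole space.\<close>
    have "card ?\<Omega>' * card {\<omega> \<in> agree ?\<Omega> ?S {} (\<lambda>_. {}). accepts t (\<lambda>x i. map_option (\<lambda>e. \<Phi> e (?S \<omega> e)) (g x i))}
      = card ?\<Omega> * card {\<omega> \<in> agree ?\<Omega>' (\<lambda>s. s) {} (\<lambda>_. {}). accepts t (\<lambda>x i. map_option (\<lambda>e. \<Phi> e (\<omega> e)) (g x i))}"
    proof (rule card_accepts_eq[where U = "Pow {..<k}" and m = m and q = q])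
      fix s :: "nat \<Rightarrow> nat set"
      show "num_queries t (\<lambda>x i. map_option (\<lambda>e. \<Phi> e (s e)) (g x i)) + card {} \<le> q"
        using queries inst t unfolding makes_at_most_def orc[symmetric] by simp
    next
      fix Q :: "nat set" and \<tau> :: "nat \<Rightarrow> nat set"
      assume "Q \<subseteq> {..<m}" "card Q \<le> q" "\<forall>e\<in>Q. \<tau> e \<in> Pow {..<k}"
      with qq show "card ?\<Omega>' * card (agree ?\<Omega> ?S Q \<tau>) = card ?\<Omega> * card (agree ?\<Omega>' (\<lambda>s. s) Q \<tau>)"
        by (intro card_agree_planted_shift[OF k ex hn v]) auto
    qed (use planted_in gm in \<open>auto simp: shift_space_def PiE_iff intro!: finite_PiE\<close>)
    then show ?thesis by (simp add: agree_def orc)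
  qed
  let ?acc = "\<lambda>s. measure_pmf.prob A {t. accepts t (csp_oracle n (I s))}"
  have avg: "real (card ?\<Omega>') * (\<Sum>\<omega>\<in>?\<Omega>. ?acc (?S \<omega>)) = real (card ?\<Omega>) * (\<Sum>s\<in>?\<Omega>'. ?acc s)"
    by (rule sum_prob_eq_of_card_eq) (use eq in auto)
  have yes: "2 / 3 \<le> ?acc (?S \<omega>)" if "\<omega> \<in> ?\<Omega>" for \<omega>
  proof -
    have "satisfiable (cstrs (I (?S \<omega>)))"
      unfolding I_def
    proof (rule satisfiable_shift_csp)
      fix e assume "e < m"
      moreover have "snd \<omega> \<in> PiE {..<m} (\<lambda>_. Pow {..<r})" using that unfolding planted_space_def mem_Times_iff by blast
      ultimately have "snd \<omega> e \<in> Pow {..<r}" by (simp add: PiE_iff)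
      moreover have "sym_diff {i. i < k \<and> h e i \<in> fst \<omega>} (?S \<omega> e) = {i. i < k \<and> odd (card (snd \<omega> e \<inter> v i))}"
        by (auto simp: planted_def)
      ultimately show "sym_diff {i. i < k \<and> h e i \<in> fst \<omega>} (?S \<omega> e) \<in> V"
        unfolding V_def by (intro image_eqI)
    qed
    then show ?thesis using tester inst by (simp add: is_tester_def)
  qed
  \<comment> \<open>The \<open>- 1\<close> pays for the rounding in \<open>m = n * d div k\<close>,
    which makes \<open>n * d / k\<close> as large as \<open>m + 1\<close>.\<close>
  define y where "y = real m * (p + \<epsilon>) - 1"
  define \<theta> where "\<theta> = real k * \<epsilon> / 20"
  \<comment> \<open>The bad shifts: some assignment satisfies at least \<open>y\<close>
    edges.\<close>
  define B where "B = (\<Union>\<sigma>\<in>Pow {..<n}.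
    {s \<in> ?\<Omega>'. y \<le> real (card {e. e < m \<and> sym_diff {i. i < k \<and> h e i \<in> \<sigma>} (s e) \<in> V})})"
  have "n * d < (m + 1) * k"
    unfolding m_def using k by (simp add: dividend_less_div_times)
  then have "real n * real d < (real m + 1) * real k"
    by (metis of_nat_1 of_nat_add of_nat_less_iff of_nat_mult)
  then have m1: "real n * real d / real k \<le> real m + 1"
    using k by (simp add: field_simps)
  have far: "far_from_sat \<delta> k d n (I s)" if s: "s \<in> ?\<Omega>' - B" for s
    unfolding I_def
  proof (rule far_from_sat_shift_csp)
    show "inj_on (\<lambda>e. shift_cstr k V h e (s e)) {..<m}" by (rule inj_on_shift_cstr[OF k ex q0(2)])
    fix \<sigma> assume \<sigma>: "\<sigma> \<subseteq> {..<n}"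
    have "real (card {e. e < m \<and> sym_diff {i. i < k \<and> h e i \<in> \<sigma>} (s e) \<in> V}) \<le> y"
    proof (rule ccontr)
      assume not_le: "\<not> ?thesis"
      have "s \<in> ?\<Omega>'" "s \<notin> B" using s by auto
      moreover from this(1) have "s \<in> B"
        unfolding B_def using \<sigma> not_le by (intro UN_I[of \<sigma>]) simp_all
      ultimately show False by simp
    qed
    also have "y \<le> real m - \<delta> * (real m + 1)"
    proof -
      have "real m - \<delta> * (real m + 1) = y + (p + \<epsilon>)"
        unfolding \<delta>_def y_def p_def by (simp add: algebra_simps add_divide_distrib)
      then show ?thesis using p0 \<epsilon> by linarith
    qed
    also have "\<dots> \<le> real m - \<delta> * (real n * real d / real k)"
      using m1 \<delta> by (intro diff_left_mono mult_left_mono) (auto simp: \<delta>_def)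
    finally show "real (card {e. e < m \<and> sym_diff {i. i < k \<and> h e i \<in> \<sigma>} (s e) \<in> V})
        \<le> real m - \<delta> * real d * real n / real k" by (simp add: mult_ac)
  qed (rule hn)
  have no: "?acc s \<le> 1 / 3" if s: "s \<in> ?\<Omega>' - B" for s
  proof -
    have "2 / 3 \<le> measure_pmf.prob A {t. \<not> accepts t (csp_oracle n (I s))}"
      using tester inst far[OF s] by (simp add: is_tester_def \<delta>_def)
    also have "{t. \<not> accepts t (csp_oracle n (I s))} = UNIV - {t. accepts t (csp_oracle n (I s))}" by auto
    also have "measure_pmf.prob A \<dots> = 1 - ?acc s"
      using measure_pmf.prob_compl[of "{t. accepts t (csp_oracle n (I s))}" A] by simp
    finally show ?thesis by simp
  qed
  have card_shift: "real (card ?\<Omega>') = (2 ^ k) ^ m"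
    by (simp add: shift_space_def card_PiE card_Pow)
  have B: "2 * real (card B) < real (card ?\<Omega>')"
  proof -
    have "real (card B) \<le> (\<Sum>\<sigma>\<in>Pow {..<n}. real (card
        {s \<in> ?\<Omega>'. y \<le> real (card {e. e < m \<and> sym_diff {i. i < k \<and> h e i \<in> \<sigma>} (s e) \<in> V})}))"
      unfolding B_def of_nat_sum[symmetric] by (intro of_nat_mono card_UN_le) auto
    also have "\<dots> \<le> (\<Sum>\<sigma>\<in>Pow {..<n}. (2 ^ k) ^ m * exp (real m * (2 * real k / 2 ^ k * (exp \<theta> - 1)) - \<theta> * y))"
      using V \<epsilon> by (intro sum_mono card_many_satisfied_le) (auto simp: \<theta>_def)
    also have "\<dots> = (2 ^ k) ^ m * (2 ^ n * exp (real m * (p * (exp \<theta> - 1)) - \<theta> * (real m * (p + \<epsilon>) - 1)))"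
      by (simp add: card_Pow p_def y_def)
    finally have "2 * real (card B) \<le> (2 ^ k) ^ m * (2 * 2 ^ n * exp (real m * (p * (exp \<theta> - 1)) - \<theta> * (real m * (p + \<epsilon>) - 1)))"
      by simp
    also have "\<dots> < (2 ^ k) ^ m * 1"
      using union_bound_exponent[OF k \<epsilon> \<epsilon>1 d m1 large] by (simp add: \<theta>_def p_def)
    finally show ?thesis by (simp add: card_shift)
  qed
  have BO: "B \<subseteq> ?\<Omega>'" by (auto simp: B_def)
  then have finB: "finite B" by (rule finite_subset) simp
  have "(\<Sum>s\<in>?\<Omega>'. ?acc s) = (\<Sum>s\<in>?\<Omega>' - B. ?acc s) + (\<Sum>s\<in>B. ?acc s)"
    using BO by (simp add: sum.subset_diff)
  also have "\<dots> \<le> (\<Sum>s\<in>?\<Omega>' - B. 1 / 3) + (\<Sum>s\<in>B. 1)"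
    by (intro add_mono sum_mono no) auto
  also have "\<dots> = (real (card ?\<Omega>') - real (card B)) / 3 + real (card B)"
    using BO finB by (simp add: card_Diff_subset card_mono of_nat_diff)
  also have "\<dots> < 2 / 3 * real (card ?\<Omega>')"
  proof -
    have "(x - b) / 3 + b < 2 / 3 * x" if "2 * b < x" for x b :: real
      using that by argo
    with B show ?thesis by blast
  qed
  finally have lt: "(\<Sum>s\<in>?\<Omega>'. ?acc s) < 2 / 3 * real (card ?\<Omega>')" .
  have "(\<Sum>\<omega>\<in>?\<Omega>. 2 / 3) \<le> (\<Sum>\<omega>\<in>?\<Omega>. ?acc (?S \<omega>))" by (intro sum_mono yes)
  then have "real (card ?\<Omega>') * (2 / 3 * real (card ?\<Omega>)) \<le> real (card ?\<Omega>') * (\<Sum>\<omega>\<in>?\<Omega>. ?acc (?S \<omega>))"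
    by (intro mult_left_mono) (auto simp: mult.commute)
  also have "\<dots> = real (card ?\<Omega>) * (\<Sum>s\<in>?\<Omega>'. ?acc s)" by (rule avg)
  also have "\<dots> < real (card ?\<Omega>) * (2 / 3 * real (card ?\<Omega>'))"
    using lt by (intro mult_strict_left_mono) (auto simp: card_gt_0_iff)
  finally show False by simp
qed

text \<open>For a nonpositive distance the empty instance is both satisfiable and far, so it would
  have to be accepted and rejected with probability \<open>2 / 3\<close> each.\<close>

lemma no_tester_nonpos:
  assumes "\<delta> \<le> 0"
  shows "\<not> is_tester \<delta> k d n A"
proof
  assume tester: "is_tester \<delta> k d n A"
  define I where "I = \<lparr>cstrs = {}, incident = \<lambda>_. []\<rparr>"
  have "\<delta> * real d * real n / real k \<le> 0"
    using assms by (intro divide_nonpos_nonneg mult_nonpos_nonneg) auto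
  then have "far_from_sat \<delta> k d n I"
    unfolding far_from_sat_def by (auto intro: order_trans)
  moreover have "I \<in> csp_instances k d n" "satisfiable (cstrs I)"
    by (auto simp: I_def csp_instances_def satisfiable_def)
  ultimately have "2 / 3 \<le> measure_pmf.prob A {t. accepts t (csp_oracle n I)}"
    "2 / 3 \<le> measure_pmf.prob A {t. \<not> accepts t (csp_oracle n I)}"
    using tester by (auto simp: is_tester_def)
  moreover have "{t. \<not> accepts t (csp_oracle n I)} = UNIV - {t. accepts t (csp_oracle n I)}" by auto
  ultimately show False
    using measure_pmf.prob_compl[of "{t. accepts t (csp_oracle n I)}" A] by simp
qed

theorem theorem5:
  "\<exists>C::real. C > 0 \<and>
     (\<forall>(\<epsilon>::real) (k::nat). \<epsilon> > 0 \<longrightarrow> k \<ge> 3 \<longrightarrow>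
       (\<exists>d::nat. d \<ge> 1 \<and> (\<epsilon> \<le> 1 \<longrightarrow> real d \<le> C / \<epsilon>\<^sup>2) \<and>
         (\<exists>c::real. c > 0 \<and>
           (\<forall>\<^sub>F n in sequentially. \<forall>(A::algo pmf) (q::nat).
              is_tester (1 - 2 * real k / 2 ^ k - \<epsilon>) k d n A \<longrightarrow> makes_at_most k d n A q \<longrightarrow>
              c * real n \<le> real q))))"
proof (intro exI[of _ "41 :: real"] conjI allI impI)
  fix \<epsilon> :: real and k :: nat
  assume \<epsilon>: "\<epsilon> > 0" and k: "k \<ge> 3"
  define \<delta> where "\<delta> = 1 - 2 * real k / 2 ^ k - \<epsilon>"
  \<comment> \<open>For \<open>\<epsilon> \<le> 1\<close> this absorbs the rounding up in
    \<open>d\<close>, whence 41 instead of 40.\<close>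
  have inv: "1 \<le> 1 / \<epsilon>\<^sup>2" if "\<epsilon> \<le> 1" using that \<epsilon> by (simp add: power_le_one)
  define d where "d = nat \<lceil>40 / \<epsilon>\<^sup>2\<rceil>"
  have "0 < 40 / \<epsilon>\<^sup>2" using \<epsilon> by simp
  then have "real d \<le> 40 / \<epsilon>\<^sup>2 + 1" "40 / \<epsilon>\<^sup>2 \<le> real d" "d > 0"
    unfolding d_def by linarith+
  then have d: "\<epsilon> \<le> 1 \<longrightarrow> real d \<le> 41 / \<epsilon>\<^sup>2" "40 / \<epsilon>\<^sup>2 \<le> real d" "d \<ge> 1"
    using inv by auto
  define K where "K = 4 * exp (2 * real k + 2) * (real d)\<^sup>2 * real k ^ 3"
  have K: "K > 0" using k d by (simp add: K_def)
  have "\<forall>\<^sub>F n in sequentially. \<forall>(A::algo pmf) (q::nat).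
          is_tester \<delta> k d n A \<longrightarrow> makes_at_most k d n A q \<longrightarrow> 1 / K * real n \<le> real q"
  proof (cases "\<delta> \<le> 0")
    case True
    then show ?thesis using no_tester_nonpos by simp
  next
    case False
    have ln2: "ln 2 < (1 :: real)" using ln_less_self[of 2] ln_2_less_1 by simp
    have "filterlim (\<lambda>n. real n * (1 - ln 2)) at_top sequentially"
      using ln2 by (intro filterlim_at_top_mult_tendsto_pos[OF tendsto_const _ filterlim_real_sequentially]) simp
    then have "\<forall>\<^sub>F n in sequentially. ln 2 + real k * \<epsilon> / 20 + real k * \<epsilon> / 20 * \<epsilon> / 2 < real n * (1 - ln 2)"
      by (simp add: filterlim_at_top_dense)
    \<comment> \<open>The bound \<open>2 * K\<close> gives \<open>q0 \<ge> 2\<close>, which makes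
      the scopes of different edges distinct.\<close>
    moreover have "\<forall>\<^sub>F n in sequentially. max 1 (2 * K) \<le> real n"
      using filterlim_real_sequentially by (simp only: filterlim_at_top)
    ultimately show ?thesis
    proof eventually_elim
      case (elim n)
      show ?case
      proof (intro allI impI)
        fix A :: "algo pmf" and q :: nat
        assume A: "is_tester \<delta> k d n A" "makes_at_most k d n A q"
        \<comment> \<open>The largest set size for which expansion is available;
          \<open>q0 < q\<close> then means \<open>q \<ge> q0 + 1 > n / K\<close>.\<close>
        define q0 where "q0 = nat \<lfloor>real n / K\<rfloor>"
        have "2 \<le> real n / K" using elim(2) K by (simp add: field_simps)
        then have q0: "real q0 \<le> real n / K" "real n / K < real q0 + 1" "q0 \<ge> 2"
          unfolding q0_def by linarith+
        have Kq0: "K * real q0 \<le> real n" using q0(1) K by (simp add: field_simps)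
        have "q0 < q"
        proof (rule tester_queries_gt[OF k \<epsilon> _ d(2) _ elim(1) _ q0(3)])
          show "0 < 1 - 2 * real k / 2 ^ k - \<epsilon>" using False by (simp add: \<delta>_def)
          show "0 < n" using elim(2) by simp
        qed (use A Kq0 in \<open>simp_all only: \<delta>_def K_def\<close>)
        then have "real q0 + 1 \<le> real q" by linarith
        with q0(2) show "1 / K * real n \<le> real q" by simp
      qed
    qed
  qed
  then show "\<exists>d::nat. d \<ge> 1 \<and> (\<epsilon> \<le> 1 \<longrightarrow> real d \<le> 41 / \<epsilon>\<^sup>2) \<and>
         (\<exists>c::real. c > 0 \<and>
           (\<forall>\<^sub>F n in sequentially. \<forall>(A::algo pmf) (q::nat).
              is_tester (1 - 2 * real k / 2 ^ k - \<epsilon>) k d n A \<longrightarrow> makes_at_most k d n A q \<longrightarrow>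
              c * real n \<le> real q))"
    using d(1,3) K unfolding \<delta>_def by (intro exI[of _ d] conjI exI[of _ "1 / K"]) simp_all
qed simp

end
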